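(* In the general Bayes factor setting described in the context, let $\tau$ be a stopping time with $\bar P_0(\tau=\infty\mid x^m)=\bar P_1(\tau=\infty\mid x^m)=0$, and let $\gamma_\tau=\sum_{j=m+1}^\infty \mathbf 1_{\{\tau=j\}}\gamma_j$ be the stopped posterior odds. Then for ($\rho^{(m)}$-almost) every $x^m\in\langle\mathcal X^m\rangle$: $$\text{for } \bar P_0^{[\gamma_\tau]}(\cdot\mid x^m)\text{-almost all } b:\qquad \frac{\pi(H_1\mid x^m)}{\pi(H_0\mid x^m)}\cdot\frac{\mathrm d\bar P_1^{[\gamma_\tau]}(\cdot\mid x^m)}{\mathrm d\bar P_0^{[\gamma_\tau]}(\cdot\mid x^m)}(b)=b,$$ and also $$\text{for } \bar P_0^{[\gamma_\tau]}(\cdot\mid x^m)\text{-almost all } b:\qquad \frac{\pi(H_1)}{\pi(H_0)}\cdot\frac{\mathrm d\bar P_1^{[\gamma_\tau]}}{\mathrm d\bar P_0^{[\gamma_\tau]}}(b)=b.$$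
   Context: General setting. $(\Omega,\mathcal F)$ is a measurable space, $m\ge 0$ an integer, and $X_{m+1},X_{m+2},\dots$ are measurable functions on $\Omega$ with values in a measurable space $(\mathcal X,\Sigma)$. If $m>0$ there is in addition an initial sample $\langle X^{(m)}\rangle:\Omega\to\langle\mathcal X^m\rangle\subseteq\mathcal X^m$, where $\langle\mathcal X^m\rangle$ carries a $\sigma$-algebra. If $m=0$ there is no initial sample and conditioning on $x^m$ is vacuous. For $n\ge m$, $\langle\mathcal X^n\rangle=\{x^n\in\mathcal X^n:(x_1,\dots,x_m)\in\langle\mathcal X^m\rangle\}$ with the product $\sigma$-algebra, $X^n=(\langle X^{(m)}\rangle,X_{m+1},\dots,X_n)$, and $\mathcal F_n$ is the $\sigma$-algebra on $\Omega$ generated by $X^n$. For $x^n\in\langle\mathcal X^n\rangle$, $x^m$ denotes its initial segment. A stopping time is a function $\tau:\Omega\to\{m+1,m+2,\dots\}\cup\{\infty\}$ with $\{\tau=n\}\in\mathcal F_n$ for all $n>m$. For a measure $Q$ on $(\Omega,\mathcal F)$, $Q^{(n)}$ is the distribution of $X^n$ under $Q$. Hypotheses. For $k\in\{0,1\}$, $H_k=\{P_{\theta\mid k}:\theta\in\Theta_k\}$ is a set of probability measures on $(\Omega,\mathcal F)$, $\Theta_k$ carries a suitable $\sigma$-algebra, and $\pi_k$ is a possibly improper (infinite) prior measure on $\Theta_k$. The Bayes marginal is $\bar P_k(A)=\int_{\Theta_k}P_{\theta\mid k}(A)\,\mathrm d\pi_k(\theta)$, a possibly infinite measure. $\pi(H_0),\pi(H_1)>0$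 are prior probabilities of the hypotheses. Standing assumptions. For all $n\ge\max\{m,1\}$, all $k$ and $\theta\in\Theta_k$, the measures $P^{(n)}_{\theta\mid k},\bar P_0^{(n)},\bar P_1^{(n)}$ are mutually absolutely continuous, and $\bar P_0^{(n)},\bar P_1^{(n)}$ are $\sigma$-finite. $\rho$ is a measure on $(\Omega,\mathcal F)$ such that for these $n$, $\rho^{(n)}$ is mutually absolutely continuous with them (e.g. $\rho^{(n)}=\bar P_0^{(n)}$). For every $x^m\in\langle\mathcal X^m\rangle$ the posterior $$\pi_k(\Theta_k'\mid x^m)=\frac{\int_{\Theta_k'}\frac{\mathrm dP^{(m)}_{\theta\mid k}}{\mathrm d\rho^{(m)}}(x^m)\,\mathrm d\pi_k(\theta)}{\int_{\Theta_k}\frac{\mathrm dP^{(m)}_{\theta\mid k}}{\mathrm d\rho^{(m)}}(x^m)\,\mathrm d\pi_k(\theta)}$$ is a probability measure (for $m=0$ it is the prior $\pi_k$, which is then proper). Conditional marginals. $\bar P_k(A\mid x^m)=\int_{\Theta_k}P_{\theta\mid k}(A\mid\langle X^{(m)}\rangle=x^m)\,\mathrm d\pi_k(\theta\mid x^m)$, where $P_{\theta\mid k}(A\mid\langle X^{(m)}\rangle=x^m)$ is the value at $x^m$ of a version of the conditional probability given $\mathcal F_m$, thus defined up to a set of $\rho^{(m)}$-measure $0$. $\bar P_k(\cdot\mid x^m)$ is a probability measure on $(\Omega,\mathcal F)$. Bayes factor and posterior odds. $\beta_n=\dfrac{\mathrm d\bar P_1^{(n)}/\mathrm d\rho^{(n)}}{\mathrm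 d\bar P_0^{(n)}/\mathrm d\rho^{(n)}}(X^n)$, and the posterior odds are $\gamma_n=\dfrac{\pi(H_1\mid X^n)}{\pi(H_0\mid X^n)}=\beta_n\cdot\dfrac{\pi(H_1)}{\pi(H_0)}$. In particular $\pi(H_1\mid x^m)/\pi(H_0\mid x^m)$ is the value of $\gamma_m$ at $x^m$ (the prior odds if $m=0$). Induced measures. For a measure $P$ on $(\Omega,\mathcal F)$ and a random variable $B$, $P^{[B]}(A)=P(B\in A)$ for Borel $A\subseteq\mathbb R_{>0}$. Thus $\bar P_k^{[\gamma_\tau]}(\cdot\mid x^m)$ and $\bar P_k^{[\gamma_\tau]}$ are the distributions of $\gamma_\tau$ under $\bar P_k(\cdot\mid x^m)$ and $\bar P_k$. The latter may be infinite. An identity $\frac{\mathrm d\nu}{\mathrm d\mu}(b)=f(b)$ for almost all $b$ means that $f$ is a version of the density, i.e. $\nu(A)=\int_A f\,\mathrm d\mu$ for all Borel $A\subseteq\mathbb R_{>0}$. The assumption that $\tau$ is almost surely finite is imposed for every $x^m\in\langle\mathcal X^m\rangle$. *)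

theory Defs
  imports "HOL-Probability.Probability"
begin

text \<open>
  Hypotheses are indexed by \<open>k \<in> {0, 1}\<close>. The measures on \<open>sample_space\<close>, \<open>outcome_space\<close> and
  \<open>init_space\<close> are irrelevant, only their underlying measurable spaces are used.
  Initial samples are extensional functions on \<open>{1..init_len}\<close>; if \<open>init_len = 0\<close> there is only
  the empty tuple, so that conditioning on it is vacuous.
  Both hypotheses share the type of parameters, but their parameter spaces
  \<open>space (prior 0)\<close> and \<open>space (prior 1)\<close> are unrelated.

  The last three components are versions of objects that are only determined almost
  everywhere:
  \<open>likelihood k \<theta> x\<close> of the density of the law of the initial sample under \<open>model k \<theta>\<close>,
  \<open>cond_model k \<theta> x A\<close> of the conditional probability of \<open>A\<close> given the initial sample \<open>x\<close>, and
  \<open>marginal_density k n\<close> of the density of the Bayes marginal of the first \<open>n\<close> observations.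
\<close>

record ('w, 'x, 't) bayes_model =
  sample_space :: "'w measure"
  outcome_space :: "'x measure"
  init_len :: nat
  init_space :: "(nat \<Rightarrow> 'x) measure"
  init_sample :: "'w \<Rightarrow> nat \<Rightarrow> 'x"
  observation :: "nat \<Rightarrow> 'w \<Rightarrow> 'x"
  prior :: "nat \<Rightarrow> 't measure"
  model :: "nat \<Rightarrow> 't \<Rightarrow> 'w measure"
  hyp_prior :: "nat \<Rightarrow> real"
  reference :: "'w measure"
  likelihood :: "nat \<Rightarrow> 't \<Rightarrow> (nat \<Rightarrow> 'x) \<Rightarrow> ennreal"
  cond_model :: "nat \<Rightarrow> 't \<Rightarrow> (nat \<Rightarrow> 'x) \<Rightarrow> 'w set \<Rightarrow> ennreal"
  marginal_density :: "nat \<Rightarrow> nat \<Rightarrow> (nat \<Rightarrow> 'x) \<Rightarrow> ennreal"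

definition is_density :: "'a measure \<Rightarrow> 'a measure \<Rightarrow> ('a \<Rightarrow> ennreal) \<Rightarrow> bool" where
  "is_density \<mu> \<nu> f \<longleftrightarrow> f \<in> borel_measurable \<mu> \<and> density \<mu> f = \<nu>"

definition mutually_ac :: "'a measure \<Rightarrow> 'a measure \<Rightarrow> bool" where
  "mutually_ac \<mu> \<nu> \<longleftrightarrow> absolutely_continuous \<mu> \<nu> \<and> absolutely_continuous \<nu> \<mu>"

text \<open>The induced measure on the Borel subsets of the positive reals.\<close>

definition positive_law :: "'w measure \<Rightarrow> ('w \<Rightarrow> real) \<Rightarrow> real measure" where
  "positive_law P Y = restrict_space (distr P borel Y) {0<..}"

text \<open>
  \<open>obs_space B n\<close> is only meaningful for \<open>n \<ge> init_len B\<close>. Splitting a tuple after its initial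
  segment identifies it with a subset of a binary product, from which it inherits the product
  sigma-algebra; for \<open>n = init_len B\<close> this is the sigma-algebra of \<open>init_space B\<close>.
\<close>

definition obs_space :: "('w, 'x, 't) bayes_model \<Rightarrow> nat \<Rightarrow> (nat \<Rightarrow> 'x) measure" where
  "obs_space B n =
    vimage_algebra
      {x \<in> {1..n} \<rightarrow>\<^sub>E space (outcome_space B). restrict x {1..init_len B} \<in> space (init_space B)}
      (\<lambda>x. (restrict x {1..init_len B}, restrict x {init_len B + 1..n}))
      (init_space B \<Otimes>\<^sub>M (\<Pi>\<^sub>M i\<in>{init_len B + 1..n}. outcome_space B))"

definition obs :: "('w, 'x, 't) bayes_model \<Rightarrow> nat \<Rightarrow> 'w \<Rightarrow> nat \<Rightarrow> 'x" where
  "obs B n \<omega> = (\<lambda>i\<in>{1..n}. if i \<le> init_len B then init_sample B \<omega> i else observation B i \<omega>)"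

definition obs_algebra :: "('w, 'x, 't) bayes_model \<Rightarrow> nat \<Rightarrow> 'w measure" where
  "obs_algebra B n = vimage_algebra (space (sample_space B)) (obs B n) (obs_space B n)"

definition obs_law :: "('w, 'x, 't) bayes_model \<Rightarrow> nat \<Rightarrow> 'w measure \<Rightarrow> (nat \<Rightarrow> 'x) measure" where
  "obs_law B n Q = distr Q (obs_space B n) (obs B n)"

text \<open>
  \<^const>\<open>bind\<close> is used with a possibly infinite prior: the mass of \<open>A\<close> is the integral of
  \<open>emeasure (model B k \<theta>) A\<close> with respect to \<open>prior B k\<close>.
\<close>

definition bayes_marginal :: "('w, 'x, 't) bayes_model \<Rightarrow> nat \<Rightarrow> 'w measure" where
  "bayes_marginal B k = prior B k \<bind> model B k"

definition posterior :: "('w, 'x, 't) bayes_model \<Rightarrow> nat \<Rightarrow> (nat \<Rightarrow> 'x) \<Rightarrow> 't measure" where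
  "posterior B k x =
    (if init_len B = 0 then prior B k
     else density (prior B k)
       (\<lambda>\<theta>. likelihood B k \<theta> x / (\<integral>\<^sup>+\<theta>'. likelihood B k \<theta>' x \<partial>prior B k)))"

text \<open>
  By the convention of \<^const>\<open>measure_of\<close>, this is the null measure, in particular not a
  probability measure, unless the given set function is countably additive.
\<close>

definition cond_marginal :: "('w, 'x, 't) bayes_model \<Rightarrow> nat \<Rightarrow> (nat \<Rightarrow> 'x) \<Rightarrow> 'w measure" where
  "cond_marginal B k x =
    measure_of (space (sample_space B)) (sets (sample_space B))
      (\<lambda>A. \<integral>\<^sup>+\<theta>. cond_model B k \<theta> x A \<partial>posterior B k x)"

definition prior_odds :: "('w, 'x, 't) bayes_model \<Rightarrow> real" where
  "prior_odds B = hyp_prior B 1 / hyp_prior B 0"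

definition bayes_factor :: "('w, 'x, 't) bayes_model \<Rightarrow> nat \<Rightarrow> (nat \<Rightarrow> 'x) \<Rightarrow> real" where
  "bayes_factor B n x = enn2real (marginal_density B 1 n x / marginal_density B 0 n x)"

definition posterior_odds :: "('w, 'x, 't) bayes_model \<Rightarrow> nat \<Rightarrow> 'w \<Rightarrow> real" where
  "posterior_odds B n \<omega> = bayes_factor B n (obs B n \<omega>) * prior_odds B"

definition init_odds :: "('w, 'x, 't) bayes_model \<Rightarrow> (nat \<Rightarrow> 'x) \<Rightarrow> real" where
  "init_odds B x =
    (if init_len B = 0 then prior_odds B else bayes_factor B (init_len B) x * prior_odds B)"

definition is_stopping_time :: "('w, 'x, 't) bayes_model \<Rightarrow> ('w \<Rightarrow> enat) \<Rightarrow> bool" where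
  "is_stopping_time B \<tau> \<longleftrightarrow>
    (\<forall>\<omega>\<in>space (sample_space B). enat (init_len B) < \<tau> \<omega>) \<and>
    (\<forall>n>init_len B. {\<omega> \<in> space (sample_space B). \<tau> \<omega> = enat n} \<in> sets (obs_algebra B n))"

definition stopped_odds :: "('w, 'x, 't) bayes_model \<Rightarrow> ('w \<Rightarrow> enat) \<Rightarrow> 'w \<Rightarrow> real" where
  "stopped_odds B \<tau> \<omega> =
    (\<Sum>i. let j = init_len B + 1 + i in indicator {\<omega>. \<tau> \<omega> = enat j} \<omega> * posterior_odds B j \<omega>)"

locale bayes_factor_setting =
  fixes B :: "('w, 'x, 't) bayes_model"
  assumes init_space_subset:
      "space (init_space B) \<subseteq> {1..init_len B} \<rightarrow>\<^sub>E space (outcome_space B)"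
    and init_sample_measurable: "init_sample B \<in> sample_space B \<rightarrow>\<^sub>M init_space B"
    and observation_measurable:
      "\<And>n. n > init_len B \<Longrightarrow> observation B n \<in> sample_space B \<rightarrow>\<^sub>M outcome_space B"
    and model_kernel:
      "\<And>k. k \<in> {0, 1} \<Longrightarrow> model B k \<in> prior B k \<rightarrow>\<^sub>M prob_algebra (sample_space B)"
    and hyp_prior: "\<And>k. k \<in> {0, 1} \<Longrightarrow> 0 < hyp_prior B k \<and> hyp_prior B k \<le> 1"
    and sets_reference: "sets (reference B) = sets (sample_space B)"
    and marginal_sigma_finite:
      "\<And>k n. k \<in> {0, 1} \<Longrightarrow> n \<ge> max (init_len B) 1 \<Longrightarrow>
        sigma_finite_measure (obs_law B n (bayes_marginal B k))"
    and reference_sigma_finite: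
      "\<And>n. n \<ge> max (init_len B) 1 \<Longrightarrow> sigma_finite_measure (obs_law B n (reference B))"
    and model_mutually_ac:
      "\<And>k \<theta> n. k \<in> {0, 1} \<Longrightarrow> \<theta> \<in> space (prior B k) \<Longrightarrow> n \<ge> max (init_len B) 1 \<Longrightarrow>
        mutually_ac (obs_law B n (model B k \<theta>)) (obs_law B n (reference B))"
    and marginal_mutually_ac:
      "\<And>k n. k \<in> {0, 1} \<Longrightarrow> n \<ge> max (init_len B) 1 \<Longrightarrow>
        mutually_ac (obs_law B n (bayes_marginal B k)) (obs_law B n (reference B))"
    and marginal_density:
      "\<And>k n. k \<in> {0, 1} \<Longrightarrow> n \<ge> max (init_len B) 1 \<Longrightarrow>
        is_density (obs_law B n (reference B)) (obs_law B n (bayes_marginal B k))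
          (marginal_density B k n)"
    and likelihood_measurable:
      "\<And>k. k \<in> {0, 1} \<Longrightarrow> init_len B > 0 \<Longrightarrow>
        (\<lambda>(\<theta>, x). likelihood B k \<theta> x) \<in> borel_measurable (prior B k \<Otimes>\<^sub>M init_space B)"
    and likelihood:
      "\<And>k \<theta>. k \<in> {0, 1} \<Longrightarrow> init_len B > 0 \<Longrightarrow> \<theta> \<in> space (prior B k) \<Longrightarrow>
        is_density (obs_law B (init_len B) (reference B)) (obs_law B (init_len B) (model B k \<theta>))
          (likelihood B k \<theta>)"
    and posterior_prob_space:
      "\<And>k x. k \<in> {0, 1} \<Longrightarrow> x \<in> space (init_space B) \<Longrightarrow> prob_space (posterior B k x)"
    and cond_model_measurable:
      "\<And>k A. k \<in> {0, 1} \<Longrightarrow> A \<in> sets (sample_space B) \<Longrightarrow>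
        (\<lambda>(\<theta>, x). cond_model B k \<theta> x A) \<in> borel_measurable (prior B k \<Otimes>\<^sub>M init_space B)"
    and cond_model:
      "\<And>k \<theta> A. k \<in> {0, 1} \<Longrightarrow> \<theta> \<in> space (prior B k) \<Longrightarrow> A \<in> sets (sample_space B) \<Longrightarrow>
        AE \<omega> in model B k \<theta>. cond_model B k \<theta> (init_sample B \<omega>) A =
          nn_cond_exp (model B k \<theta>) (obs_algebra B (init_len B)) (indicator A) \<omega>"
    and cond_marginal_prob_space:
      "\<And>k x. k \<in> {0, 1} \<Longrightarrow> x \<in> space (init_space B) \<Longrightarrow> prob_space (cond_marginal B k x)"

end

theory Submission
  imports Defs
begin

text \<open>
  On \<open>{\<tau> = n}\<close> the stopped posterior odds equal \<open>\<gamma>\<^sub>n\<close>, and \<open>\<gamma>\<^sub>n\<close> divided by the prior odds is the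
  likelihood ratio of the two marginals on the sigma-algebra of the first \<open>n\<close> observations. So
  \<open>P\<^sub>1(\<gamma>\<^sub>\<tau> \<in> A, \<tau> = n)\<close> is the integral of \<open>\<gamma>\<^sub>\<tau>\<close> over the same event under \<open>P\<^sub>0\<close>, divided by the
  prior odds. Summing over \<open>n\<close> gives the unconditional claim: the law of \<open>\<gamma>\<^sub>\<tau>\<close> under \<open>P\<^sub>1\<close> has
  density \<open>b\<close> over the prior odds with respect to its law under \<open>P\<^sub>0\<close>. Outcomes with
  \<open>\<tau> = \<infinity>\<close> have \<open>\<gamma>\<^sub>\<tau> = 0\<close> and do not enter the law on the positive reals. The event identity, joint
  with an event of the initial sample, is \<open>emeasure_stopped_change\<close>.

  For the conditional claim, the conditional marginals disintegrate the marginals: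
  integrating \<open>P\<^sub>k(\<cdot> | x)\<close> over initial samples \<open>x \<in> C\<close> against the marginal law of the initial
  sample gives \<open>P\<^sub>k\<close> restricted to the event that the initial sample lies in \<open>C\<close>
  (\<open>disintegration\<close>). In the integrand the posterior weights have the marginal likelihood of \<open>x\<close> as
  denominator, and this cancels against the density of the marginal law; what remains is a
  Tonelli exchange of \<open>x\<close> and \<open>\<theta>\<close>. The prior may be infinite, but sigma-finiteness of the marginal
  laws forces it to be sigma-finite (\<open>prior_sigma_finite\<close>), so the exchange is allowed.

  Integrating the joint event identity in this way over arbitrary \<open>C\<close> determines
  the integrands almost everywhere. For each fixed Borel set \<open>A\<close> this gives an identity between
  \<open>P\<^sub>1(\<gamma>\<^sub>\<tau> \<in> A | x)\<close> and an integral under \<open>P\<^sub>0(\<cdot> | x)\<close>, outside a null set of \<open>x\<close> that depends on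
  \<open>A\<close>. Countably many rays with rational endpoints determine a finite measure on the line, so a
  single null set suffices (\<open>is_density_positive_law_finite\<close>). The ratio of the two marginal
  likelihoods at \<open>x\<close> turns the prior odds into the odds after the initial sample.
\<close>

section \<open>Extended reals and measures on the real line\<close>

lemma ennreal_mult_enn2real_divide:
  fixes a b :: ennreal
  assumes "0 < a" "a < \<infinity>" "b < \<infinity>"
  shows "a * ennreal (enn2real (b / a)) = b"
proof -
  have "b / a < top"
    using assms by (auto simp: ennreal_divide_eq_top_iff less_top[symmetric])
  then have "a * ennreal (enn2real (b / a)) = b * a / a"
    by (simp add: ennreal_enn2real ennreal_times_divide mult.commute)
  also have "\<dots> = b"
    using assms by (intro mult_divide_eq_ennreal) auto
  finally show ?thesis .
qed

lemma greaterThan_of_rat_Int: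
  "{of_rat p<..} \<inter> {of_rat q<..} = {of_rat (max p q) :: real<..}"
proof -
  have "real_of_rat (max p q) = max (of_rat p) (of_rat q)"
    by (simp add: max_def of_rat_less_eq)
  then show ?thesis by auto
qed

text \<open>
  Half-lines with rational endpoints generate the Borel sets and are stable under
  intersection. Countability of this generator is what allows exceptional null sets to be
  merged later on.
\<close>

lemma measure_eqI_greaterThan_rat:
  fixes M N :: "real measure"
  assumes "sets M = sets borel" "sets N = sets borel"
    and "\<And>q :: rat. emeasure M {of_rat q<..} < \<infinity>"
    and "\<And>q :: rat. emeasure M {of_rat q<..} = emeasure N {of_rat q<..}"
  shows "M = N"
proof -
  let ?E = "range (\<lambda>q :: rat. {of_rat q :: real<..})"
  have borel_eq: "(borel :: real measure) = sigma UNIV ?E"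
  proof (rule borel_eq_sigmaI1[OF borel_Ioi])
    fix X :: "real set" assume "X \<in> range greaterThan"
    then obtain a where X: "X = {a<..}" by auto
    have "X = (\<Union>q \<in> {q :: rat. a < of_rat q}. {of_rat q<..})"
      unfolding X by (auto dest: of_rat_dense intro: less_trans)
    also have "\<dots> \<in> sets (sigma UNIV ?E)"
      by (intro sets.countable_UN') (auto simp: sets_measure_of_conv)
    finally show "X \<in> sets (sigma UNIV ?E)" .
  qed auto
  have "sets (borel :: real measure) = sets (sigma UNIV ?E)"
    using borel_eq by (rule arg_cong)
  also have "\<dots> = sigma_sets UNIV ?E"
    by (rule sets_measure_of) auto
  finally have sets_eq: "sets (borel :: real measure) = sigma_sets UNIV ?E" .
  show ?thesis
  proof (rule measure_eqI_generator_eq_countable[where E = ?E and A = ?E and \<Omega> = UNIV])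
    show "Int_stable ?E"
      by (auto intro!: Int_stableI simp: greaterThan_of_rat_Int)
    have "x \<in> \<Union> ?E" for x :: real
      using of_rat_dense[of "x - 1" x] by auto
    then show "\<Union> ?E = (UNIV :: real set)" by blast
  qed (use assms sets_eq in \<open>auto simp: less_top[symmetric]\<close>)
qed

text \<open>
  Change of variables: it suffices to compare the two measures on events of the form
  \<open>Y \<in> A\<close>, where the density \<open>b / c\<close> pulls back to \<open>Y / c\<close>. Since Bayes
  marginals may be infinite, all Borel sets are compared here.
\<close>

lemma is_density_positive_law:
  fixes Y :: "'w \<Rightarrow> real"
  assumes [measurable]: "Y \<in> borel_measurable P"
    and sets_Q: "sets Q = sets P"
    and c: "c > 0"
    and eq: "\<And>A. A \<in> sets borel \<Longrightarrow> A \<subseteq> {0<..} \<Longrightarrow>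
      emeasure Q (Y -` A \<inter> space P) = (\<integral>\<^sup>+\<omega>. ennreal (Y \<omega> / c) * indicator A (Y \<omega>) \<partial>P)"
  shows "is_density (positive_law P Y) (positive_law Q Y) (\<lambda>b. ennreal (b / c))"
  unfolding is_density_def
proof (intro conjI measure_eqI)
  have [measurable]: "Y \<in> borel_measurable Q"
    using assms(1) by (simp cong: measurable_cong_sets add: sets_Q)
  have sp: "space Q = space P" using sets_Q by (rule sets_eq_imp_space_eq)
  have sets_law: "sets (positive_law M Y) = sets (restrict_space borel {0<..})" for M
    by (simp add: positive_law_def sets_restrict_space)
  show "(\<lambda>b. ennreal (b / c)) \<in> borel_measurable (positive_law P Y)"
    unfolding positive_law_def by (rule measurable_restrict_space1) simp
  note meas = this
  show "sets (density (positive_law P Y) (\<lambda>b. ennreal (b / c))) = sets (positive_law Q Y)"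
    by (simp add: sets_law)
  fix A assume "A \<in> sets (density (positive_law P Y) (\<lambda>b. ennreal (b / c)))"
  then have A: "A \<in> sets (restrict_space borel {0::real<..})" by (simp add: sets_law)
  then have A_borel[measurable]: "A \<in> sets borel" and A_pos: "A \<subseteq> {0<..}"
    by (auto simp: sets_restrict_space)
  have "emeasure (density (positive_law P Y) (\<lambda>b. ennreal (b / c))) A =
      (\<integral>\<^sup>+b. ennreal (b / c) * indicator A b \<partial>positive_law P Y)"
    using A by (intro emeasure_density meas) (simp add: sets_law)
  also have "\<dots> = (\<integral>\<^sup>+b. ennreal (b / c) * indicator A b * indicator {0<..} b \<partial>distr P borel Y)"
    unfolding positive_law_def by (rule nn_integral_restrict_space) simp
  also have "\<dots> = (\<integral>\<^sup>+b. ennreal (b / c) * indicator A b \<partial>distr P borel Y)"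
    using A_pos by (intro nn_integral_cong) (auto split: split_indicator)
  also have "\<dots> = (\<integral>\<^sup>+\<omega>. ennreal (Y \<omega> / c) * indicator A (Y \<omega>) \<partial>P)"
    by (subst nn_integral_distr) auto
  also have "\<dots> = emeasure Q (Y -` A \<inter> space P)"
    by (rule eq[symmetric]) fact+
  also have "\<dots> = emeasure (distr Q borel Y) A"
    by (subst emeasure_distr) (auto simp: sp)
  also have "\<dots> = emeasure (positive_law Q Y) A"
    unfolding positive_law_def using A_pos by (subst emeasure_restrict_space) auto
  finally show "emeasure (density (positive_law P Y) (\<lambda>b. ennreal (b / c))) A =
      emeasure (positive_law Q Y) A" .
qed

text \<open>
  For finite \<open>Q\<close> the comparison on countably many events is enough, so that it can be verified
  for almost every initial sample at once.
\<close>

lemma is_density_positive_law_finite: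
  fixes Y :: "'w \<Rightarrow> real"
  assumes [measurable]: "Y \<in> borel_measurable P"
    and sets_Q: "sets Q = sets P"
    and fin: "finite_measure Q"
    and c: "c > 0"
    and eq: "\<And>q :: rat. q \<ge> 0 \<Longrightarrow> emeasure Q (Y -` {of_rat q<..} \<inter> space P) =
      (\<integral>\<^sup>+\<omega>. ennreal (Y \<omega> / c) * indicator {of_rat q<..} (Y \<omega>) \<partial>P)"
  shows "is_density (positive_law P Y) (positive_law Q Y) (\<lambda>b. ennreal (b / c))"
proof (rule is_density_positive_law)
  interpret Q: finite_measure Q by fact
  have [measurable]: "Y \<in> borel_measurable Q"
    using assms(1) by (simp cong: measurable_cong_sets add: sets_Q)
  have sp: "space Q = space P" using sets_Q by (rule sets_eq_imp_space_eq)
  \<comment> \<open>The laws of \<open>Y\<close> are cut off at zero but kept on the whole line, where the generator is available.\<close>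
  define M where "M = density (distr Q borel Y) (indicator {0<..})"
  define N where "N = density (distr P borel Y) (\<lambda>b. ennreal (b / c) * indicator {0<..} b)"
  have M: "emeasure M A = emeasure Q (Y -` (A \<inter> {0<..}) \<inter> space P)"
    if [measurable]: "A \<in> sets borel" for A
  proof -
    have "emeasure M A = (\<integral>\<^sup>+b. indicator {0<..} b * indicator A b \<partial>distr Q borel Y)"
      unfolding M_def by (rule emeasure_density) simp_all
    also have "\<dots> = (\<integral>\<^sup>+b. indicator (A \<inter> {0<..}) b \<partial>distr Q borel Y)"
      by (rule nn_integral_cong) (auto split: split_indicator)
    also have "\<dots> = emeasure (distr Q borel Y) (A \<inter> {0<..})"
      by (rule nn_integral_indicator) simp
    also have "\<dots> = emeasure Q (Y -` (A \<inter> {0<..}) \<inter> space P)"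
      by (subst emeasure_distr) (auto simp: sp)
    finally show ?thesis .
  qed
  have N: "emeasure N A = (\<integral>\<^sup>+\<omega>. ennreal (Y \<omega> / c) * indicator (A \<inter> {0<..}) (Y \<omega>) \<partial>P)"
    if [measurable]: "A \<in> sets borel" for A
  proof -
    have "emeasure N A = (\<integral>\<^sup>+b. ennreal (b / c) * indicator (A \<inter> {0<..}) b \<partial>distr P borel Y)"
      unfolding N_def by (subst emeasure_density) (auto intro!: nn_integral_cong split: split_indicator)
    then show ?thesis by (subst (asm) nn_integral_distr) auto
  qed
  have "M = N"
  proof (rule measure_eqI_greaterThan_rat)
    fix q :: rat
    have "{of_rat q<..} \<inter> {0<..} = {of_rat (max q 0) :: real<..}"
      using greaterThan_of_rat_Int[of q 0] by simp
    then show "emeasure M {of_rat q<..} = emeasure N {of_rat q<..}"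
      using eq[of "max q 0"] by (simp add: M N)
    show "emeasure M {of_rat q<..} < \<infinity>"
      by (simp add: M Q.emeasure_eq_measure)
  qed (simp_all add: M_def N_def)
  fix A :: "real set" assume "A \<in> sets borel" "A \<subseteq> {0<..}"
  then show "emeasure Q (Y -` A \<inter> space P) =
      (\<integral>\<^sup>+\<omega>. ennreal (Y \<omega> / c) * indicator A (Y \<omega>) \<partial>P)"
    using M[of A] N[of A] \<open>M = N\<close> by (simp add: Int_absorb2)
qed fact+

section \<open>Observations\<close>

context bayes_factor_setting
begin

lemma init_sample_in_space:
  "\<omega> \<in> space (sample_space B) \<Longrightarrow> init_sample B \<omega> \<in> space (init_space B)"
  using init_sample_measurable by (rule measurable_space)

lemma measurable_split_obs:
  "(\<lambda>x. (restrict x {1..init_len B}, restrict x {init_len B + 1..n})) \<in>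
    obs_space B n \<rightarrow>\<^sub>M init_space B \<Otimes>\<^sub>M (\<Pi>\<^sub>M i\<in>{init_len B + 1..n}. outcome_space B)"
  unfolding obs_space_def
  by (rule measurable_vimage_algebra1) (auto simp: space_pair_measure space_PiM PiE_def Pi_def)

lemma measurable_initial_segment [measurable]:
  "(\<lambda>x. restrict x {1..init_len B}) \<in> obs_space B n \<rightarrow>\<^sub>M init_space B"
  using measurable_fst'[OF measurable_split_obs] by simp

lemma restrict_obs_init:
  assumes "n \<ge> init_len B" "\<omega> \<in> space (sample_space B)"
  shows "restrict (obs B n \<omega>) {1..init_len B} = init_sample B \<omega>"
  using init_sample_in_space[OF assms(2)] init_space_subset assms(1)
  by (fastforce simp: obs_def fun_eq_iff PiE_def extensional_def)

lemma measurable_obs: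
  assumes "n \<ge> init_len B"
  shows "obs B n \<in> sample_space B \<rightarrow>\<^sub>M obs_space B n"
  unfolding obs_space_def
proof (rule measurable_vimage_algebra2)
  note init = restrict_obs_init[OF assms]
  have rest: "restrict (obs B n \<omega>) {init_len B + 1..n} = (\<lambda>i\<in>{init_len B + 1..n}. observation B i \<omega>)"
    for \<omega>
    by (auto simp: obs_def fun_eq_iff)
  show "obs B n \<in> space (sample_space B) \<rightarrow>
      {x \<in> {1..n} \<rightarrow>\<^sub>E space (outcome_space B). restrict x {1..init_len B} \<in> space (init_space B)}"
  proof (intro Pi_I CollectI conjI)
    fix \<omega> assume \<omega>: "\<omega> \<in> space (sample_space B)"
    show "restrict (obs B n \<omega>) {1..init_len B} \<in> space (init_space B)"
      unfolding init[OF \<omega>] by (rule init_sample_in_space[OF \<omega>])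
    have "init_sample B \<omega> i \<in> space (outcome_space B)" if "i \<in> {1..init_len B}" for i
      using init_sample_in_space[OF \<omega>] init_space_subset that by (blast intro: PiE_mem)
    then show "obs B n \<omega> \<in> {1..n} \<rightarrow>\<^sub>E space (outcome_space B)"
      using measurable_space[OF observation_measurable \<omega>]
      by (auto simp: obs_def PiE_def not_le)
  qed
  have "(\<lambda>\<omega>. (init_sample B \<omega>, \<lambda>i\<in>{init_len B + 1..n}. observation B i \<omega>)) \<in> sample_space B \<rightarrow>\<^sub>M
      init_space B \<Otimes>\<^sub>M (\<Pi>\<^sub>M i\<in>{init_len B + 1..n}. outcome_space B)"
    by (intro measurable_Pair measurable_restrict init_sample_measurable observation_measurable) auto
  then show "(\<lambda>\<omega>. (restrict (obs B n \<omega>) {1..init_len B}, restrict (obs B n \<omega>) {init_len B + 1..n})) \<in>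
      sample_space B \<rightarrow>\<^sub>M init_space B \<Otimes>\<^sub>M (\<Pi>\<^sub>M i\<in>{init_len B + 1..n}. outcome_space B)"
    by (rule measurable_cong[THEN iffD1, rotated]) (simp only: init rest)
qed

lemma measurable_obs_sets:
  assumes "n \<ge> init_len B" "sets Q = sets (sample_space B)"
  shows "obs B n \<in> Q \<rightarrow>\<^sub>M obs_space B n"
  using measurable_obs[OF assms(1)] unfolding measurable_cong_sets[OF assms(2) refl] .

lemma obs_init_len:
  assumes "\<omega> \<in> space (sample_space B)"
  shows "obs B (init_len B) \<omega> = init_sample B \<omega>"
  using restrict_obs_init[OF order_refl assms] by (simp add: obs_def)

text \<open>
  For tuples of the length of the initial sample the second factor of the split is trivial,
  and the identity map is measurable in both directions.
\<close>

lemma sets_obs_space_init: "sets (obs_space B (init_len B)) = sets (init_space B)"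
proof -
  have restrict_id: "restrict x {1..init_len B} = x" if "x \<in> {1..init_len B} \<rightarrow>\<^sub>E space (outcome_space B)" for x
    using that by (auto simp: fun_eq_iff PiE_def extensional_def)
  have space_eq: "space (obs_space B (init_len B)) = space (init_space B)"
    using init_space_subset restrict_id by (auto simp: obs_space_def)
  have to_init: "(\<lambda>x. x) \<in> obs_space B (init_len B) \<rightarrow>\<^sub>M init_space B"
    by (rule measurable_cong[THEN iffD1, OF _ measurable_initial_segment])
      (use space_eq init_space_subset restrict_id in auto)
  have from_init: "(\<lambda>x. x) \<in> init_space B \<rightarrow>\<^sub>M obs_space B (init_len B)"
    unfolding obs_space_def
  proof (rule measurable_vimage_algebra2)
    have "(\<lambda>x. (x, \<lambda>i\<in>{init_len B + 1..init_len B}. undefined)) \<in> init_space B \<rightarrow>\<^sub>M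
        init_space B \<Otimes>\<^sub>M (\<Pi>\<^sub>M i\<in>{init_len B + 1..init_len B}. outcome_space B)"
      by (intro measurable_Pair measurable_restrict) auto
    then show "(\<lambda>x. (restrict x {1..init_len B}, restrict x {init_len B + 1..init_len B})) \<in>
        init_space B \<rightarrow>\<^sub>M init_space B \<Otimes>\<^sub>M (\<Pi>\<^sub>M i\<in>{init_len B + 1..init_len B}. outcome_space B)"
      by (rule measurable_cong[THEN iffD1, rotated])
        (use init_space_subset in \<open>auto simp del: One_nat_def intro!: restrict_id[symmetric]\<close>)
  qed (use init_space_subset restrict_id in auto)
  show ?thesis
  proof (intro antisym subsetI)
    fix A assume "A \<in> sets (obs_space B (init_len B))"
    then show "A \<in> sets (init_space B)"
      using measurable_sets[OF from_init, of A] sets.Int_space_eq2[of A "obs_space B (init_len B)"] space_eq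
      by simp
  next
    fix A assume "A \<in> sets (init_space B)"
    then show "A \<in> sets (obs_space B (init_len B))"
      using measurable_sets[OF to_init, of A] sets.Int_space_eq2[of A "init_space B"] space_eq
      by simp
  qed
qed

lemma space_obs_space_init: "space (obs_space B (init_len B)) = space (init_space B)"
  using sets_obs_space_init by (rule sets_eq_imp_space_eq)

lemma space_obs_algebra [simp]: "space (obs_algebra B n) = space (sample_space B)"
  by (simp add: obs_algebra_def)

lemma measurable_obs_algebra:
  assumes "n \<ge> init_len B"
  shows "obs B n \<in> obs_algebra B n \<rightarrow>\<^sub>M obs_space B n"
  unfolding obs_algebra_def
  using measurable_obs[OF assms] by (intro measurable_vimage_algebra1) (auto dest: measurable_space)

lemma subalgebra_obs_algebra:
  assumes "n \<ge> init_len B" "sets P = sets (sample_space B)"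
  shows "subalgebra P (obs_algebra B n)"
proof -
  have "sets (obs_algebra B n) \<subseteq> sets (sample_space B)"
    using measurable_sets[OF measurable_obs[OF assms(1)]] measurable_space[OF measurable_obs[OF assms(1)]]
    unfolding obs_algebra_def by (subst sets_vimage_algebra2) auto
  then show ?thesis
    using assms(2) sets_eq_imp_space_eq[OF assms(2)] by (simp add: subalgebra_def obs_algebra_def)
qed

lemma measurable_init_sample_obs_algebra:
  assumes "n \<ge> init_len B"
  shows "init_sample B \<in> obs_algebra B n \<rightarrow>\<^sub>M init_space B"
proof -
  have "(\<lambda>\<omega>. restrict (obs B n \<omega>) {1..init_len B}) \<in> obs_algebra B n \<rightarrow>\<^sub>M init_space B"
    using measurable_obs_algebra[OF assms] measurable_initial_segment by (rule measurable_compose)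
  then show ?thesis
    by (rule measurable_cong[THEN iffD1, rotated])
      (rule restrict_obs_init, use assms in \<open>auto simp: obs_algebra_def\<close>)
qed

lemma sets_obs_algebraE:
  assumes "S \<in> sets (obs_algebra B n)" "n \<ge> init_len B"
  obtains E where "E \<in> sets (obs_space B n)" "S = obs B n -` E \<inter> space (sample_space B)"
  using assms measurable_space[OF measurable_obs[OF assms(2)]]
  unfolding obs_algebra_def by (subst (asm) sets_vimage_algebra2) auto

end

section \<open>Marginals\<close>

context bayes_factor_setting
begin

lemma sets_obs_law [simp, measurable_cong]: "sets (obs_law B n Q) = sets (obs_space B n)"
  by (simp add: obs_law_def)

lemma space_obs_law [simp]: "space (obs_law B n Q) = space (obs_space B n)"
  by (simp add: obs_law_def)

lemma measurable_obs_law_iff [simp]: "measurable (obs_law B n Q) N = measurable (obs_space B n) N"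
  by (rule measurable_cong_sets) simp_all

lemma
  assumes "k \<in> {0, 1}" "\<theta> \<in> space (prior B k)"
  shows sets_model: "sets (model B k \<theta>) = sets (sample_space B)"
    and prob_space_model: "prob_space (model B k \<theta>)"
  using measurable_space[OF model_kernel[OF assms(1)] assms(2)] by (auto simp: space_prob_algebra)

lemma space_prior_nonempty:
  assumes "k \<in> {0, 1}" "space (init_space B) \<noteq> {}"
  shows "space (prior B k) \<noteq> {}"
proof -
  obtain x where "x \<in> space (init_space B)" using assms(2) by auto
  then interpret prob_space "posterior B k x" by (rule posterior_prob_space[OF assms(1)])
  show ?thesis using not_empty by (simp add: posterior_def split: if_splits)
qed

lemma model_subprob_kernel:
  "k \<in> {0, 1} \<Longrightarrow> model B k \<in> prior B k \<rightarrow>\<^sub>M subprob_algebra (sample_space B)"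
  by (rule measurable_prob_algebraD[OF model_kernel])

lemma sets_bayes_marginal:
  assumes "k \<in> {0, 1}" "space (init_space B) \<noteq> {}"
  shows "sets (bayes_marginal B k) = sets (sample_space B)"
  unfolding bayes_marginal_def
  by (rule sets_bind[OF sets_model[OF assms(1)] space_prior_nonempty[OF assms]])

lemma nn_integral_bayes_marginal:
  assumes "k \<in> {0, 1}" "f \<in> borel_measurable (sample_space B)"
  shows "(\<integral>\<^sup>+\<omega>. f \<omega> \<partial>bayes_marginal B k) = (\<integral>\<^sup>+\<theta>. \<integral>\<^sup>+\<omega>. f \<omega> \<partial>model B k \<theta> \<partial>prior B k)"
  unfolding bayes_marginal_def by (rule nn_integral_bind[OF assms(2) model_subprob_kernel[OF assms(1)]])

lemma nn_integral_obs_law: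
  assumes "n \<ge> init_len B" "sets Q = sets (sample_space B)" "f \<in> borel_measurable (obs_space B n)"
  shows "(\<integral>\<^sup>+x. f x \<partial>obs_law B n Q) = (\<integral>\<^sup>+\<omega>. f (obs B n \<omega>) \<partial>Q)"
  unfolding obs_law_def
  using assms(3) by (intro nn_integral_distr[OF measurable_obs_sets[OF assms(1,2)]]) simp

text \<open>
  Take an integrable, strictly positive function \<open>h\<close> of the first observations. Its
  expectation \<open>g \<theta>\<close> under each model is strictly positive, and integrates to the finite integral
  of \<open>h\<close> under the marginal. A measure with a strictly positive integrable function is
  sigma-finite.
\<close>

lemma prior_sigma_finite:
  assumes k: "k \<in> {0, 1}" and ne: "space (init_space B) \<noteq> {}"
  shows "sigma_finite_measure (prior B k)"
proof -
  \<comment> \<open>Marginal laws are only known to be sigma-finite from the first observation on.\<close>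
  define n where "n = max (init_len B) 1"
  have n: "n \<ge> max (init_len B) 1" "n \<ge> init_len B" by (simp_all add: n_def)
  interpret M: sigma_finite_measure "obs_law B n (bayes_marginal B k)"
    by (rule marginal_sigma_finite[OF k n(1)])
  obtain h where h_meas: "h \<in> borel_measurable (obs_law B n (bayes_marginal B k))"
    and h_fin: "(\<integral>\<^sup>+x. h x \<partial>obs_law B n (bayes_marginal B k)) \<noteq> \<infinity>"
    and h_pos: "\<And>x. x \<in> space (obs_space B n) \<Longrightarrow> 0 < h x"
    using M.Ex_finite_integrable_function by (auto simp: Ball_def)
  have h[measurable]: "h \<in> borel_measurable (obs_space B n)"
    using h_meas by simp
  note [measurable] = measurable_obs[OF n(2)]
  define H where "H = (\<lambda>\<omega>. h (obs B n \<omega>))"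
  have H[measurable]: "H \<in> borel_measurable (sample_space B)" unfolding H_def by measurable
  define g where "g \<theta> = (\<integral>\<^sup>+\<omega>. H \<omega> \<partial>model B k \<theta>)" for \<theta>
  have g_meas[measurable]: "g \<in> borel_measurable (prior B k)"
    unfolding g_def
    by (rule measurable_compose[OF model_subprob_kernel[OF k] nn_integral_measurable_subprob_algebra[OF H]])
  have g_fin: "(\<integral>\<^sup>+\<theta>. g \<theta> \<partial>prior B k) \<noteq> \<infinity>"
    using h_fin nn_integral_bayes_marginal[OF k H]
      nn_integral_obs_law[OF n(2) sets_bayes_marginal[OF k ne] h]
    by (simp add: g_def H_def)
  have g_pos: "g \<theta> \<noteq> 0" if \<theta>: "\<theta> \<in> space (prior B k)" for \<theta>
  proof
    interpret prob_space "model B k \<theta>" by (rule prob_space_model[OF k \<theta>])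
    note [measurable_cong] = sets_model[OF k \<theta>]
    assume "g \<theta> = 0"
    then have "AE \<omega> in model B k \<theta>. H \<omega> = 0"
      unfolding g_def by (subst (asm) nn_integral_0_iff_AE) auto
    moreover have "AE \<omega> in model B k \<theta>. H \<omega> \<noteq> 0"
      using h_pos measurable_space[OF measurable_obs[OF n(2)]] sets_eq_imp_space_eq[OF sets_model[OF k \<theta>]]
      by (intro AE_I2) (metis H_def less_irrefl)
    ultimately have "AE \<omega> in model B k \<theta>. False" by eventually_elim simp
    then show False using AE_False by simp
  qed
  interpret F: finite_measure "density (prior B k) g"
    using g_fin by (intro finite_measureI) (simp add: emeasure_density cong: nn_integral_cong)
  have "AE \<theta> in prior B k. g \<theta> \<noteq> \<infinity>"
    by (rule nn_integral_noteq_infinite) (use g_fin in auto)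
  then have "AE \<theta> in prior B k. g \<theta> * (1 / g \<theta>) = 1"
    using AE_space by eventually_elim (auto simp: g_pos ennreal_times_divide ennreal_divide_self less_top)
  then have "density (prior B k) (\<lambda>\<theta>. g \<theta> * (1 / g \<theta>)) = density (prior B k) (\<lambda>_. 1)"
    by (intro density_cong) auto
  \<comment> \<open>The prior is recovered from a finite measure by an almost everywhere finite density.\<close>
  then have "prior B k = density (density (prior B k) g) (\<lambda>\<theta>. 1 / g \<theta>)"
    by (subst density_density_eq) (auto simp: density_1)
  moreover have "sigma_finite_measure (density (density (prior B k) g) (\<lambda>\<theta>. 1 / g \<theta>))"
  proof (subst F.sigma_finite_iff_density_finite)
    have "AE \<theta> in prior B k. 1 / g \<theta> \<noteq> \<infinity>"
      using AE_space by eventually_elim (auto simp: g_pos ennreal_divide_eq_top_iff)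
    then show "AE \<theta> in density (prior B k) g. 1 / g \<theta> \<noteq> \<infinity>"
      by (subst AE_density) auto
  qed auto
  ultimately show ?thesis by simp
qed

lemma measurable_marginal_density:
  assumes "k \<in> {0, 1}" "n \<ge> max (init_len B) 1"
  shows "marginal_density B k n \<in> borel_measurable (obs_space B n)"
  using marginal_density[OF assms] by (simp add: is_density_def)

lemma density_marginal_density:
  assumes "k \<in> {0, 1}" "n \<ge> max (init_len B) 1"
  shows "density (obs_law B n (reference B)) (marginal_density B k n) = obs_law B n (bayes_marginal B k)"
  using marginal_density[OF assms] by (simp add: is_density_def)

text \<open>
  Finiteness comes from sigma-finiteness of the marginal law, and positivity from its having the
  same null sets as the reference law. Thus the Bayes factor is almost everywhere a genuine
  quotient.
\<close>

lemma AE_marginal_density: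
  assumes k: "k \<in> {0, 1}" and n: "n \<ge> max (init_len B) 1"
  shows "AE x in obs_law B n (reference B). 0 < marginal_density B k n x \<and> marginal_density B k n x < \<infinity>"
proof -
  interpret R: sigma_finite_measure "obs_law B n (reference B)"
    by (rule reference_sigma_finite[OF n])
  have meas[measurable]: "marginal_density B k n \<in> borel_measurable (obs_space B n)"
    by (rule measurable_marginal_density[OF k n])
  have "AE x in obs_law B n (reference B). marginal_density B k n x \<noteq> \<infinity>"
    using marginal_sigma_finite[OF k n]
      R.sigma_finite_iff_density_finite[of "marginal_density B k n"]
    by (simp add: density_marginal_density[OF k n])
  moreover have "AE x in obs_law B n (reference B). 0 < marginal_density B k n x"
  proof (rule absolutely_continuous_AE)
    show "absolutely_continuous (obs_law B n (bayes_marginal B k)) (obs_law B n (reference B))"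
      using marginal_mutually_ac[OF k n] by (simp add: mutually_ac_def)
    show "AE x in obs_law B n (bayes_marginal B k). 0 < marginal_density B k n x"
      unfolding density_marginal_density[OF k n, symmetric] by (subst AE_density) auto
  qed simp
  ultimately show ?thesis
    by eventually_elim (simp add: less_top)
qed

lemma measurable_bayes_factor:
  assumes "n \<ge> max (init_len B) 1"
  shows "bayes_factor B n \<in> borel_measurable (obs_space B n)"
  using measurable_marginal_density[OF _ assms, of 0] measurable_marginal_density[OF _ assms, of 1]
  unfolding bayes_factor_def by simp

lemma bayes_factor_density:
  assumes n: "n \<ge> max (init_len B) 1"
  shows "density (obs_law B n (bayes_marginal B 0)) (\<lambda>x. ennreal (bayes_factor B n x)) =
    obs_law B n (bayes_marginal B 1)"
proof -
  have dens: "density (obs_law B n (reference B)) (marginal_density B 0 n) = obs_law B n (bayes_marginal B 0)"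
      "density (obs_law B n (reference B)) (marginal_density B 1 n) = obs_law B n (bayes_marginal B 1)"
    by (auto intro!: density_marginal_density n)
  have meas[measurable]: "marginal_density B 0 n \<in> borel_measurable (obs_space B n)"
      "marginal_density B 1 n \<in> borel_measurable (obs_space B n)"
      "bayes_factor B n \<in> borel_measurable (obs_space B n)"
    by (auto intro!: measurable_marginal_density measurable_bayes_factor n)
  have "AE x in obs_law B n (reference B).
      marginal_density B 0 n x * ennreal (bayes_factor B n x) = marginal_density B 1 n x"
    using AE_marginal_density[of 0, OF insertI1 n] AE_marginal_density[of 1, OF insertI2[OF singletonI] n]
    by eventually_elim (simp add: bayes_factor_def ennreal_mult_enn2real_divide)
  then have "density (obs_law B n (reference B))
      (\<lambda>x. marginal_density B 0 n x * ennreal (bayes_factor B n x)) = obs_law B n (bayes_marginal B 1)"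
    unfolding dens(2)[symmetric]
    by (intro density_cong) (use meas in auto)
  then show ?thesis
    unfolding dens(1)[symmetric]
    by (subst density_density_eq) auto
qed

text \<open>
  The Bayes factor is the likelihood ratio of the two marginals on the sigma-algebra of the first
  \<open>n\<close> observations.
\<close>

lemma emeasure_marginal_change:
  assumes n: "n \<ge> max (init_len B) 1" and ne: "space (init_space B) \<noteq> {}"
    and S: "S \<in> sets (obs_algebra B n)"
  shows "emeasure (bayes_marginal B 1) S =
    (\<integral>\<^sup>+\<omega>. ennreal (bayes_factor B n (obs B n \<omega>)) * indicator S \<omega> \<partial>bayes_marginal B 0)"
proof -
  have n': "n \<ge> init_len B" using n by simp
  obtain E where E[measurable]: "E \<in> sets (obs_space B n)"
    and S_eq: "S = obs B n -` E \<inter> space (sample_space B)"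
    using sets_obs_algebraE[OF S n'] by blast
  note sets = sets_bayes_marginal[OF _ ne]
  note sp = sets_eq_imp_space_eq[OF sets]
  note [measurable] = measurable_bayes_factor[OF n]
  have "emeasure (bayes_marginal B 1) S = emeasure (obs_law B n (bayes_marginal B 1)) E"
    unfolding obs_law_def S_eq by (subst emeasure_distr[OF measurable_obs_sets[OF n' sets]]) (auto simp: sp)
  also have "\<dots> = (\<integral>\<^sup>+x. ennreal (bayes_factor B n x) * indicator E x \<partial>obs_law B n (bayes_marginal B 0))"
    unfolding bayes_factor_density[OF n, symmetric] by (rule emeasure_density) auto
  also have "\<dots> = (\<integral>\<^sup>+\<omega>. ennreal (bayes_factor B n (obs B n \<omega>)) * indicator E (obs B n \<omega>) \<partial>bayes_marginal B 0)"
    by (rule nn_integral_obs_law[OF n' sets]) auto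
  also have "\<dots> = (\<integral>\<^sup>+\<omega>. ennreal (bayes_factor B n (obs B n \<omega>)) * indicator S \<omega> \<partial>bayes_marginal B 0)"
    by (rule nn_integral_cong) (auto simp: S_eq sp split: split_indicator)
  finally show ?thesis .
qed

end

section \<open>The stopped posterior odds\<close>

context bayes_factor_setting
begin

lemma prior_odds_pos: "prior_odds B > 0"
  using hyp_prior[of 0] hyp_prior[of 1] by (simp add: prior_odds_def)

lemma stopped_odds_eq:
  assumes "\<tau> \<omega> = enat n" "init_len B < n"
  shows "stopped_odds B \<tau> \<omega> = posterior_odds B n \<omega>"
proof -
  define i where "i = n - (init_len B + 1)"
  have "(\<lambda>l. let j = init_len B + 1 + l in indicator {\<omega>. \<tau> \<omega> = enat j} \<omega> * posterior_odds B j \<omega>) =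
      (\<lambda>l. if l = i then posterior_odds B n \<omega> else 0)"
    using assms by (auto simp: fun_eq_iff i_def Let_def)
  then show ?thesis
    unfolding stopped_odds_def
    using sums_unique[OF sums_single[of i "\<lambda>_. posterior_odds B n \<omega>"]] by simp
qed

lemma stopped_odds_infinity: "\<tau> \<omega> = \<infinity> \<Longrightarrow> stopped_odds B \<tau> \<omega> = 0"
  by (simp add: stopped_odds_def Let_def)

lemma measurable_posterior_odds:
  assumes "n \<ge> max (init_len B) 1"
  shows "posterior_odds B n \<in> borel_measurable (obs_algebra B n)"
proof -
  have "(\<lambda>\<omega>. bayes_factor B n (obs B n \<omega>)) \<in> borel_measurable (obs_algebra B n)"
    using assms by (intro measurable_compose[OF measurable_obs_algebra measurable_bayes_factor]) auto
  then show ?thesis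
    unfolding posterior_odds_def by simp
qed

lemma measurable_stopped_odds:
  assumes "is_stopping_time B \<tau>"
  shows "stopped_odds B \<tau> \<in> borel_measurable (sample_space B)"
proof -
  have "(\<lambda>\<omega>. indicator {\<omega>. \<tau> \<omega> = enat j} \<omega> * posterior_odds B j \<omega>) \<in> borel_measurable (sample_space B)"
    if j: "j > init_len B" for j
  proof -
    have sub: "subalgebra (sample_space B) (obs_algebra B j)"
      using j by (intro subalgebra_obs_algebra) auto
    have [measurable]: "{\<omega> \<in> space (sample_space B). \<tau> \<omega> = enat j} \<in> sets (sample_space B)"
      using assms j sub by (auto simp: is_stopping_time_def subalgebra_def)
    have [measurable]: "posterior_odds B j \<in> borel_measurable (sample_space B)"
      using j by (intro measurable_from_subalg[OF sub measurable_posterior_odds]) auto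
    have "(\<lambda>\<omega>. indicator {\<omega> \<in> space (sample_space B). \<tau> \<omega> = enat j} \<omega> * posterior_odds B j \<omega>)
        \<in> borel_measurable (sample_space B)"
      by simp
    then show ?thesis
      by (rule measurable_cong[THEN iffD1, rotated]) (auto split: split_indicator)
  qed
  then show ?thesis
    unfolding stopped_odds_def Let_def by (intro borel_measurable_suminf) auto
qed

text \<open>
  Split the event according to the value of the stopping time. The piece with \<open>\<tau> = n\<close> is an
  event of the first \<open>n\<close> observations, where the likelihood ratio is \<open>\<gamma>\<^sub>n\<close> divided by the prior odds
  and \<open>\<gamma>\<^sub>n\<close> is the stopped value. The event \<open>C\<close> of the initial sample belongs to all these
  sigma-algebras; it is carried along for the disintegration.
\<close>

lemma emeasure_stopped_change:
  assumes \<tau>: "is_stopping_time B \<tau>" and ne: "space (init_space B) \<noteq> {}"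
    and A: "A \<in> sets borel" "A \<subseteq> {0<..}" and C: "C \<in> sets (init_space B)"
  shows "emeasure (bayes_marginal B 1)
      {\<omega> \<in> space (sample_space B). stopped_odds B \<tau> \<omega> \<in> A \<and> init_sample B \<omega> \<in> C} =
    (\<integral>\<^sup>+\<omega>. ennreal (stopped_odds B \<tau> \<omega> / prior_odds B) *
      indicator {\<omega> \<in> space (sample_space B). stopped_odds B \<tau> \<omega> \<in> A \<and> init_sample B \<omega> \<in> C} \<omega>
      \<partial>bayes_marginal B 0)" (is "emeasure _ ?T = _")
proof -
  define S where "S i = {\<omega> \<in> space (sample_space B). \<tau> \<omega> = enat (init_len B + 1 + i) \<and>
    posterior_odds B (init_len B + 1 + i) \<omega> \<in> A \<and> init_sample B \<omega> \<in> C}" for i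
  note sets = sets_bayes_marginal[OF _ ne]
  have S_obs: "S i \<in> sets (obs_algebra B (init_len B + 1 + i))" for i
  proof -
    let ?n = "init_len B + 1 + i"
    have "{\<omega> \<in> space (sample_space B). \<tau> \<omega> = enat ?n} \<in> sets (obs_algebra B ?n)"
      using \<tau> by (simp add: is_stopping_time_def)
    moreover have "posterior_odds B ?n -` A \<inter> space (obs_algebra B ?n) \<in> sets (obs_algebra B ?n)"
      by (rule measurable_sets[OF measurable_posterior_odds A(1)]) simp
    moreover have "init_sample B -` C \<inter> space (obs_algebra B ?n) \<in> sets (obs_algebra B ?n)"
      by (rule measurable_sets[OF measurable_init_sample_obs_algebra C]) simp
    moreover have "S i = {\<omega> \<in> space (sample_space B). \<tau> \<omega> = enat ?n} \<inter>
        (posterior_odds B ?n -` A \<inter> space (obs_algebra B ?n)) \<inter>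
        (init_sample B -` C \<inter> space (obs_algebra B ?n))"
      by (auto simp: S_def)
    ultimately show ?thesis by auto
  qed
  have S_sets: "S i \<in> sets (sample_space B)" for i
    using S_obs[of i] subalgebra_obs_algebra[of "init_len B + 1 + i" "sample_space B"]
    by (auto simp: subalgebra_def)
  have S_marginal: "range S \<subseteq> sets (bayes_marginal B 0)" "range S \<subseteq> sets (bayes_marginal B 1)"
    using S_sets sets[of 0] sets[of 1] by auto
  have disj: "disjoint_family S"
    by (auto simp: disjoint_family_on_def S_def)
  have stopped_odds_eq_on_S: "stopped_odds B \<tau> \<omega> = posterior_odds B (init_len B + 1 + i) \<omega>"
    if "\<omega> \<in> S i" for \<omega> i
    by (rule stopped_odds_eq) (use that in \<open>simp_all add: S_def\<close>)
  have T_eq: "?T = (\<Union>i. S i)"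
  proof (intro set_eqI iffI)
    fix \<omega> assume T: "\<omega> \<in> ?T"
    then have "stopped_odds B \<tau> \<omega> \<noteq> 0" using A(2) by auto
    then obtain n where n: "\<tau> \<omega> = enat n"
      using stopped_odds_infinity[of \<tau> \<omega>] by (cases "\<tau> \<omega>") auto
    then have "init_len B < n" using T \<tau> by (auto simp: is_stopping_time_def)
    then obtain i where i: "n = init_len B + 1 + i"
      by (auto simp: less_iff_Suc_add)
    have "stopped_odds B \<tau> \<omega> = posterior_odds B n \<omega>"
      by (rule stopped_odds_eq) fact+
    then have "\<omega> \<in> S i"
      using T n by (simp add: S_def i)
    then show "\<omega> \<in> (\<Union>i. S i)" by blast
  next
    fix \<omega> assume "\<omega> \<in> (\<Union>i. S i)"
    then obtain i where i: "\<omega> \<in> S i" by blast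
    then have "stopped_odds B \<tau> \<omega> = posterior_odds B (init_len B + 1 + i) \<omega>"
      by (rule stopped_odds_eq_on_S)
    then show "\<omega> \<in> ?T" using i unfolding S_def by auto
  qed
  have "emeasure (bayes_marginal B 1) ?T = (\<Sum>i. emeasure (bayes_marginal B 1) (S i))"
    unfolding T_eq by (rule suminf_emeasure[symmetric, OF S_marginal(2) disj])
  also have "\<dots> = (\<Sum>i. \<integral>\<^sup>+\<omega>. ennreal (stopped_odds B \<tau> \<omega> / prior_odds B) * indicator (S i) \<omega>
      \<partial>bayes_marginal B 0)"
  proof (rule arg_cong[where f = suminf], rule ext)
    fix i
    have "emeasure (bayes_marginal B 1) (S i) = (\<integral>\<^sup>+\<omega>. ennreal (bayes_factor B (init_len B + 1 + i)
        (obs B (init_len B + 1 + i) \<omega>)) * indicator (S i) \<omega> \<partial>bayes_marginal B 0)"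
      by (rule emeasure_marginal_change[OF _ ne S_obs]) simp
    also have "\<dots> = (\<integral>\<^sup>+\<omega>. ennreal (stopped_odds B \<tau> \<omega> / prior_odds B) * indicator (S i) \<omega>
        \<partial>bayes_marginal B 0)"
    proof (rule nn_integral_cong)
      fix \<omega>
      show "ennreal (bayes_factor B (init_len B + 1 + i) (obs B (init_len B + 1 + i) \<omega>)) * indicator (S i) \<omega> =
          ennreal (stopped_odds B \<tau> \<omega> / prior_odds B) * indicator (S i) \<omega>"
        using prior_odds_pos stopped_odds_eq_on_S[of \<omega> i]
        by (cases "\<omega> \<in> S i") (simp_all add: posterior_odds_def)
    qed
    finally show "emeasure (bayes_marginal B 1) (S i) = \<dots>" .
  qed
  also have "\<dots> = (\<integral>\<^sup>+\<omega>. ennreal (stopped_odds B \<tau> \<omega> / prior_odds B) * indicator (\<Union>i. S i) \<omega>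
      \<partial>bayes_marginal B 0)"
  proof (rule nn_integral_disjoint_family[symmetric])
    have "(\<lambda>\<omega>. ennreal (stopped_odds B \<tau> \<omega> / prior_odds B)) \<in> borel_measurable (sample_space B)"
      using measurable_stopped_odds[OF \<tau>] by simp
    then show "(\<lambda>\<omega>. ennreal (stopped_odds B \<tau> \<omega> / prior_odds B)) \<in> borel_measurable (bayes_marginal B 0)"
      unfolding measurable_cong_sets[OF sets[of 0, simplified] refl] .
    show "S i \<in> sets (bayes_marginal B 0)" for i using S_marginal(1) by blast
  qed (rule disj)
  finally show ?thesis unfolding T_eq .
qed

lemma density_positive_law_bayes_marginal:
  assumes \<tau>: "is_stopping_time B \<tau>" and ne: "space (init_space B) \<noteq> {}"
  shows "is_density (positive_law (bayes_marginal B 0) (stopped_odds B \<tau>))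
    (positive_law (bayes_marginal B 1) (stopped_odds B \<tau>)) (\<lambda>b. ennreal (b / prior_odds B))"
proof (rule is_density_positive_law)
  note sets = sets_bayes_marginal[OF _ ne]
  have sp: "space (bayes_marginal B 0) = space (sample_space B)"
    by (rule sets_eq_imp_space_eq[OF sets]) simp
  show "stopped_odds B \<tau> \<in> borel_measurable (bayes_marginal B 0)"
    using measurable_stopped_odds[OF \<tau>] unfolding measurable_cong_sets[OF sets[of 0, simplified] refl] .
  show "sets (bayes_marginal B 1) = sets (bayes_marginal B 0)"
    using sets by simp
  fix A :: "real set" assume A: "A \<in> sets borel" "A \<subseteq> {0<..}"
  have "stopped_odds B \<tau> -` A \<inter> space (bayes_marginal B 0) = {\<omega> \<in> space (sample_space B).
      stopped_odds B \<tau> \<omega> \<in> A \<and> init_sample B \<omega> \<in> space (init_space B)}" (is "?S = ?T")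
    using init_sample_in_space by (auto simp: sp)
  then have "emeasure (bayes_marginal B 1) ?S =
      (\<integral>\<^sup>+\<omega>. ennreal (stopped_odds B \<tau> \<omega> / prior_odds B) * indicator ?S \<omega> \<partial>bayes_marginal B 0)"
    using emeasure_stopped_change[OF \<tau> ne A sets.top] by simp
  also have "\<dots> = (\<integral>\<^sup>+\<omega>. ennreal (stopped_odds B \<tau> \<omega> / prior_odds B) * indicator A (stopped_odds B \<tau> \<omega>)
      \<partial>bayes_marginal B 0)"
    by (intro nn_integral_cong) (auto split: split_indicator)
  finally show "emeasure (bayes_marginal B 1) ?S = \<dots>" .
qed (rule prior_odds_pos)

end

section \<open>Conditional marginals\<close>

context bayes_factor_setting
begin

text \<open>
  The defining property of conditional probability, for the chosen version as a function of the
  initial sample.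
\<close>

lemma cond_model_integral:
  assumes k: "k \<in> {0, 1}" and \<theta>: "\<theta> \<in> space (prior B k)"
    and A[measurable]: "A \<in> sets (sample_space B)" and C[measurable]: "C \<in> sets (init_space B)"
  shows "(\<integral>\<^sup>+\<omega>. indicator C (init_sample B \<omega>) * cond_model B k \<theta> (init_sample B \<omega>) A \<partial>model B k \<theta>) =
    (\<integral>\<^sup>+\<omega>. indicator C (init_sample B \<omega>) * indicator A \<omega> \<partial>model B k \<theta>)"
proof -
  interpret prob_space "model B k \<theta>" by (rule prob_space_model[OF k \<theta>])
  have A': "A \<in> sets (model B k \<theta>)" using A by (simp add: sets_model[OF k \<theta>])
  have "finite_measure_subalgebra (model B k \<theta>) (obs_algebra B (init_len B))"
    by unfold_locales (rule subalgebra_obs_algebra[OF order_refl sets_model[OF k \<theta>]])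
  then interpret S: sigma_finite_subalgebra "model B k \<theta>" "obs_algebra B (init_len B)"
    by (rule finite_measure_subalgebra_is_sigma_finite)
  have "(\<integral>\<^sup>+\<omega>. indicator C (init_sample B \<omega>) * cond_model B k \<theta> (init_sample B \<omega>) A \<partial>model B k \<theta>) =
      (\<integral>\<^sup>+\<omega>. indicator C (init_sample B \<omega>) *
        nn_cond_exp (model B k \<theta>) (obs_algebra B (init_len B)) (indicator A) \<omega> \<partial>model B k \<theta>)"
    by (rule nn_integral_cong_AE) (use cond_model[OF k \<theta> A] in \<open>eventually_elim, simp\<close>)
  also have "\<dots> = (\<integral>\<^sup>+\<omega>. indicator C (init_sample B \<omega>) * indicator A \<omega> \<partial>model B k \<theta>)"
    using measurable_init_sample_obs_algebra[OF order_refl] A'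
    by (intro S.nn_cond_exp_intg) (auto intro: measurable_compose)
  finally show ?thesis .
qed

lemma sets_cond_marginal [simp, measurable_cong]: "sets (cond_marginal B k x) = sets (sample_space B)"
  by (simp add: cond_marginal_def sets.space_closed sets.sigma_sets_eq)

lemma space_cond_marginal [simp]: "space (cond_marginal B k x) = space (sample_space B)"
  by (simp add: cond_marginal_def space_measure_of_conv)

text \<open>
  A measure built from a set function that is not countably additive would be null; being a
  probability measure excludes this.
\<close>

lemma emeasure_cond_marginal:
  assumes "k \<in> {0, 1}" "x \<in> space (init_space B)" and A: "A \<in> sets (sample_space B)"
  shows "emeasure (cond_marginal B k x) A = (\<integral>\<^sup>+\<theta>. cond_model B k \<theta> x A \<partial>posterior B k x)"
proof -
  interpret prob_space "cond_marginal B k x" by (rule cond_marginal_prob_space[OF assms(1,2)])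
  have "emeasure (cond_marginal B k x) (space (cond_marginal B k x)) \<noteq> 0"
    by (simp only: emeasure_space_1) simp
  then show ?thesis
    using A unfolding cond_marginal_def
    by (auto simp: emeasure_measure_of_conv sets.sigma_sets_eq split: if_splits)
qed

text \<open>
  Without an initial sample there is only one point \<open>x\<close> to condition on, so the conditional
  probability is constant and equal to its own expectation.
\<close>

lemma cond_marginal_no_init:
  assumes k: "k \<in> {0, 1}" and x: "x \<in> space (init_space B)" and m: "init_len B = 0"
  shows "cond_marginal B k x = bayes_marginal B k"
proof (rule measure_eqI)
  have ne: "space (init_space B) \<noteq> {}" using x by auto
  then show "sets (cond_marginal B k x) = sets (bayes_marginal B k)"
    by (simp add: sets_bayes_marginal[OF k])
  fix A assume "A \<in> sets (cond_marginal B k x)"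
  then have A: "A \<in> sets (sample_space B)" by simp
  have only: "y = x" if "y \<in> space (init_space B)" for y
    using that x init_space_subset m by (auto simp: PiE_def)
  have "cond_model B k \<theta> x A = emeasure (model B k \<theta>) A" if \<theta>: "\<theta> \<in> space (prior B k)" for \<theta>
  proof -
    interpret prob_space "model B k \<theta>" by (rule prob_space_model[OF k \<theta>])
    have init: "init_sample B \<omega> = x" if "\<omega> \<in> space (model B k \<theta>)" for \<omega>
      using that only init_sample_in_space sets_eq_imp_space_eq[OF sets_model[OF k \<theta>]] by auto
    have "cond_model B k \<theta> x A = (\<integral>\<^sup>+\<omega>. cond_model B k \<theta> x A \<partial>model B k \<theta>)"
      by (simp add: emeasure_space_1)
    also have "\<dots> = (\<integral>\<^sup>+\<omega>. indicator (space (init_space B)) (init_sample B \<omega>) *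
        cond_model B k \<theta> (init_sample B \<omega>) A \<partial>model B k \<theta>)"
      using x by (intro nn_integral_cong) (simp add: init)
    also have "\<dots> = (\<integral>\<^sup>+\<omega>. indicator (space (init_space B)) (init_sample B \<omega>) * indicator A \<omega> \<partial>model B k \<theta>)"
      by (rule cond_model_integral[OF k \<theta> A sets.top])
    also have "\<dots> = (\<integral>\<^sup>+\<omega>. indicator A \<omega> \<partial>model B k \<theta>)"
      using x by (intro nn_integral_cong) (simp add: init)
    also have "\<dots> = emeasure (model B k \<theta>) A"
      using A by (intro nn_integral_indicator) (simp add: sets_model[OF k \<theta>])
    finally show ?thesis .
  qed
  then have "emeasure (cond_marginal B k x) A = (\<integral>\<^sup>+\<theta>. emeasure (model B k \<theta>) A \<partial>prior B k)"
    unfolding emeasure_cond_marginal[OF k x A] posterior_def using m by (simp cong: nn_integral_cong)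
  also have "\<dots> = emeasure (bayes_marginal B k) A"
    unfolding bayes_marginal_def
    by (rule emeasure_bind[OF space_prior_nonempty[OF k ne] model_subprob_kernel[OF k] A, symmetric])
  finally show "emeasure (cond_marginal B k x) A = emeasure (bayes_marginal B k) A" .
qed

end

text \<open>
  The marginal likelihood of the initial sample, which is the normalising constant of the
  posterior.
\<close>

definition evidence :: "('w, 'x, 't) bayes_model \<Rightarrow> nat \<Rightarrow> (nat \<Rightarrow> 'x) \<Rightarrow> ennreal" where
  "evidence B k x = (\<integral>\<^sup>+\<theta>. likelihood B k \<theta> x \<partial>prior B k)"

text \<open>
  The empty initial sample is excluded because likelihoods and the density of its marginal law
  are only given from the first observation on. Nonemptiness makes the parameter spaces
  nonempty, which the monadic bind needs.
\<close>

locale bayes_factor_setting_init = bayes_factor_setting +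
  assumes init_len_pos: "init_len B > 0"
    and init_space_nonempty: "space (init_space B) \<noteq> {}"
begin

lemma init_len_ge: "init_len B \<ge> max (init_len B) 1"
  using init_len_pos by simp

abbreviation init_law :: "(nat \<Rightarrow> 'b) measure" where
  "init_law \<equiv> obs_law B (init_len B) (reference B)"

lemma sets_init_law: "sets init_law = sets (init_space B)"
  by (simp add: sets_obs_space_init)

lemma measurable_init_law: "measurable init_law N = measurable (init_space B) N"
  by (rule measurable_cong_sets[OF sets_init_law refl])

lemma sigma_finite_init_law: "sigma_finite_measure init_law"
  by (rule reference_sigma_finite[OF init_len_ge])

lemma measurable_likelihood:
  assumes "k \<in> {0, 1}"
  shows "(\<lambda>(x, \<theta>). likelihood B k \<theta> x) \<in> borel_measurable (init_space B \<Otimes>\<^sub>M prior B k)"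
  using measurable_pair_swap[OF likelihood_measurable[OF assms init_len_pos]] by (simp add: case_prod_beta')

lemma measurable_likelihood_parameter:
  assumes "k \<in> {0, 1}" "x \<in> space (init_space B)"
  shows "(\<lambda>\<theta>. likelihood B k \<theta> x) \<in> borel_measurable (prior B k)"
  using measurable_compose_Pair1[OF assms(2) measurable_likelihood[OF assms(1)]] by simp

lemma measurable_cond_model:
  assumes "k \<in> {0, 1}" "A \<in> sets (sample_space B)"
  shows "(\<lambda>(x, \<theta>). cond_model B k \<theta> x A) \<in> borel_measurable (init_space B \<Otimes>\<^sub>M prior B k)"
  using measurable_pair_swap[OF cond_model_measurable[OF assms]] by (simp add: case_prod_beta')

lemma measurable_evidence:
  assumes "k \<in> {0, 1}"
  shows "evidence B k \<in> borel_measurable (init_space B)"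
  unfolding evidence_def
  by (rule sigma_finite_measure.borel_measurable_nn_integral
      [OF prior_sigma_finite[OF assms init_space_nonempty] measurable_likelihood[OF assms]])

text \<open>
  Otherwise almost all posterior weights would be zero, as \<open>0 / 0\<close> and \<open>\<infinity> / \<infinity>\<close> are zero in the extended
  reals.
\<close>

lemma evidence_pos_finite:
  assumes k: "k \<in> {0, 1}" and x: "x \<in> space (init_space B)"
  shows "0 < evidence B k x" "evidence B k x < \<infinity>"
proof -
  interpret prob_space "posterior B k x" by (rule posterior_prob_space[OF assms])
  note [measurable] = measurable_likelihood_parameter[OF assms]
  have "1 = emeasure (posterior B k x) (space (prior B k))"
    using emeasure_space_1 init_len_pos by (simp add: posterior_def)
  also have "\<dots> = (\<integral>\<^sup>+\<theta>. likelihood B k \<theta> x / evidence B k x \<partial>prior B k)"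
    using init_len_pos by (simp add: posterior_def evidence_def emeasure_density cong: nn_integral_cong)
  also have "\<dots> = evidence B k x / evidence B k x"
    unfolding evidence_def by (rule nn_integral_divide) simp
  finally have "evidence B k x / evidence B k x = 1" ..
  then have "evidence B k x \<noteq> 0" "evidence B k x \<noteq> top"
    by (auto simp: divide_ennreal_def)
  then show "0 < evidence B k x" "evidence B k x < \<infinity>"
    by (auto simp: less_top zero_less_iff_neq_zero)
qed

text \<open>
  Tonelli's theorem exchanges the initial sample and the parameter. For fixed \<open>\<theta>\<close> the
  likelihood then turns the reference law of the initial sample into its law under the model.
\<close>

lemma nn_integral_likelihood:
  assumes k: "k \<in> {0, 1}"
    and u: "(\<lambda>(x, \<theta>). u x \<theta>) \<in> borel_measurable (init_space B \<Otimes>\<^sub>M prior B k)"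
  shows "(\<integral>\<^sup>+x. \<integral>\<^sup>+\<theta>. likelihood B k \<theta> x * u x \<theta> \<partial>prior B k \<partial>init_law) =
    (\<integral>\<^sup>+\<theta>. \<integral>\<^sup>+\<omega>. u (init_sample B \<omega>) \<theta> \<partial>model B k \<theta> \<partial>prior B k)"
proof -
  interpret R: sigma_finite_measure init_law by (rule sigma_finite_init_law)
  interpret P: sigma_finite_measure "prior B k" by (rule prior_sigma_finite[OF k init_space_nonempty])
  interpret pair_sigma_finite "prior B k" init_law ..
  have "(\<lambda>(x, \<theta>). likelihood B k \<theta> x * u x \<theta>) \<in> borel_measurable (init_space B \<Otimes>\<^sub>M prior B k)"
    using measurable_likelihood[OF k] u by (simp add: case_prod_beta')
  from measurable_pair_swap[OF this] have "(\<lambda>(\<theta>, x). likelihood B k \<theta> x * u x \<theta>) \<in> borel_measurable (prior B k \<Otimes>\<^sub>M init_space B)"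
    by (simp add: case_prod_beta')
  then have "(\<lambda>(\<theta>, x). likelihood B k \<theta> x * u x \<theta>) \<in> borel_measurable (prior B k \<Otimes>\<^sub>M init_law)"
    unfolding measurable_cong_sets[OF sets_pair_measure_cong[OF refl sets_init_law] refl] .
  then have "(\<integral>\<^sup>+x. \<integral>\<^sup>+\<theta>. likelihood B k \<theta> x * u x \<theta> \<partial>prior B k \<partial>init_law) =
      (\<integral>\<^sup>+\<theta>. \<integral>\<^sup>+x. likelihood B k \<theta> x * u x \<theta> \<partial>init_law \<partial>prior B k)"
    by (rule Fubini')
  also have "\<dots> = (\<integral>\<^sup>+\<theta>. \<integral>\<^sup>+\<omega>. u (init_sample B \<omega>) \<theta> \<partial>model B k \<theta> \<partial>prior B k)"
  proof (rule nn_integral_cong)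
    fix \<theta> assume \<theta>: "\<theta> \<in> space (prior B k)"
    note dens = likelihood[OF k init_len_pos \<theta>, unfolded is_density_def]
    have u_\<theta>: "(\<lambda>x. u x \<theta>) \<in> borel_measurable init_law"
      unfolding measurable_init_law using measurable_Pair1[OF u \<theta>] by simp
    have "(\<integral>\<^sup>+x. likelihood B k \<theta> x * u x \<theta> \<partial>init_law) =
        (\<integral>\<^sup>+x. u x \<theta> \<partial>density init_law (likelihood B k \<theta>))"
      using dens u_\<theta> by (intro nn_integral_density[symmetric]) auto
    also have "\<dots> = (\<integral>\<^sup>+x. u x \<theta> \<partial>obs_law B (init_len B) (model B k \<theta>))"
      using dens by simp
    also have "\<dots> = (\<integral>\<^sup>+\<omega>. u (obs B (init_len B) \<omega>) \<theta> \<partial>model B k \<theta>)"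
      using u_\<theta> by (intro nn_integral_obs_law order_refl sets_model[OF k \<theta>]) simp
    also have "\<dots> = (\<integral>\<^sup>+\<omega>. u (init_sample B \<omega>) \<theta> \<partial>model B k \<theta>)"
      by (intro nn_integral_cong) (simp add: obs_init_len sets_eq_imp_space_eq[OF sets_model[OF k \<theta>]])
    finally show "(\<integral>\<^sup>+x. likelihood B k \<theta> x * u x \<theta> \<partial>init_law) = \<dots>" .
  qed
  finally show ?thesis .
qed

lemma nn_integral_evidence:
  assumes k: "k \<in> {0, 1}" and C[measurable]: "C \<in> sets (init_space B)"
  shows "(\<integral>\<^sup>+x. evidence B k x * indicator C x \<partial>init_law) =
    emeasure (obs_law B (init_len B) (bayes_marginal B k)) C"
proof -
  have "(\<integral>\<^sup>+x. evidence B k x * indicator C x \<partial>init_law) =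
      (\<integral>\<^sup>+x. \<integral>\<^sup>+\<theta>. likelihood B k \<theta> x * indicator C x \<partial>prior B k \<partial>init_law)"
    unfolding evidence_def
    by (intro nn_integral_cong nn_integral_multc[symmetric] measurable_likelihood_parameter[OF k])
      (simp add: space_obs_space_init)
  also have "\<dots> = (\<integral>\<^sup>+\<theta>. \<integral>\<^sup>+\<omega>. indicator C (init_sample B \<omega>) \<partial>model B k \<theta> \<partial>prior B k)"
    by (rule nn_integral_likelihood[OF k]) measurable
  also have "\<dots> = (\<integral>\<^sup>+\<omega>. indicator C (init_sample B \<omega>) \<partial>bayes_marginal B k)"
    using init_sample_measurable by (intro nn_integral_bayes_marginal[OF k, symmetric]) simp
  also have "\<dots> = (\<integral>\<^sup>+\<omega>. indicator C (obs B (init_len B) \<omega>) \<partial>bayes_marginal B k)"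
    by (intro nn_integral_cong)
      (simp add: obs_init_len sets_eq_imp_space_eq[OF sets_bayes_marginal[OF k init_space_nonempty]])
  also have "\<dots> = (\<integral>\<^sup>+x. indicator C x \<partial>obs_law B (init_len B) (bayes_marginal B k))"
    by (intro nn_integral_obs_law[symmetric] order_refl sets_bayes_marginal[OF k init_space_nonempty])
      (auto intro!: borel_measurable_indicator simp: sets_obs_space_init)
  also have "\<dots> = emeasure (obs_law B (init_len B) (bayes_marginal B k)) C"
    by (rule nn_integral_indicator) (simp add: sets_obs_space_init)
  finally show ?thesis .
qed

text \<open>
  Both are densities of the marginal law of the initial sample, by
  \<open>nn_integral_evidence\<close> in the case of the evidence, and the reference law is sigma-finite.
\<close>

lemma AE_marginal_density_eq_evidence:
  assumes k: "k \<in> {0, 1}"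
  shows "AE x in init_law. marginal_density B k (init_len B) x = evidence B k x"
proof (rule sigma_finite_measure.density_unique2[OF sigma_finite_init_law])
  show "marginal_density B k (init_len B) \<in> borel_measurable init_law"
    using measurable_marginal_density[OF k init_len_ge] by simp
  then have meas: "marginal_density B k (init_len B) \<in> borel_measurable init_law" .
  show "evidence B k \<in> borel_measurable init_law"
    unfolding measurable_init_law by (rule measurable_evidence[OF k])
  fix C assume C: "C \<in> sets init_law"
  have "(\<integral>\<^sup>+x\<in>C. marginal_density B k (init_len B) x \<partial>init_law) =
      emeasure (obs_law B (init_len B) (bayes_marginal B k)) C"
    unfolding density_marginal_density[OF k init_len_ge, symmetric]
    by (rule emeasure_density[OF meas C, symmetric])
  also have "\<dots> = (\<integral>\<^sup>+x\<in>C. evidence B k x \<partial>init_law)"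
    using C by (intro nn_integral_evidence[OF k, symmetric]) (simp add: sets_obs_space_init)
  finally show "(\<integral>\<^sup>+x\<in>C. marginal_density B k (init_len B) x \<partial>init_law) = \<dots>" .
qed

text \<open>
  Multiplication by the evidence cancels the denominator of the posterior weights.
\<close>

lemma evidence_emeasure_cond_marginal:
  assumes k: "k \<in> {0, 1}" and x: "x \<in> space (init_space B)" and A: "A \<in> sets (sample_space B)"
  shows "evidence B k x * emeasure (cond_marginal B k x) A =
    (\<integral>\<^sup>+\<theta>. likelihood B k \<theta> x * cond_model B k \<theta> x A \<partial>prior B k)"
proof -
  note [measurable] = measurable_likelihood_parameter[OF k x]
  have [measurable]: "(\<lambda>\<theta>. cond_model B k \<theta> x A) \<in> borel_measurable (prior B k)"
    using measurable_compose_Pair1[OF x measurable_cond_model[OF k A]] by simp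
  note Z = evidence_pos_finite[OF k x]
  let ?I = "\<integral>\<^sup>+\<theta>. likelihood B k \<theta> x * cond_model B k \<theta> x A \<partial>prior B k"
  have "emeasure (cond_marginal B k x) A =
      (\<integral>\<^sup>+\<theta>. likelihood B k \<theta> x / evidence B k x * cond_model B k \<theta> x A \<partial>prior B k)"
    unfolding emeasure_cond_marginal[OF k x A] posterior_def
    using init_len_pos by (simp add: evidence_def nn_integral_density)
  also have "\<dots> = ?I / evidence B k x"
    by (subst nn_integral_divide[symmetric]) (auto simp: divide_ennreal_def ac_simps intro!: nn_integral_cong)
  finally have "evidence B k x * emeasure (cond_marginal B k x) A = ?I * evidence B k x / evidence B k x"
    by (simp add: ennreal_times_divide mult.commute)
  then show ?thesis
    using Z by (simp add: mult_divide_eq_ennreal less_top)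
qed

text \<open>
  Only measurability of each \<open>cond_model\<close> value in \<open>(\<theta>, x)\<close> is given. Being a kernel in \<open>x\<close> follows
  since the conditional marginals are measures and parameters can be integrated out.
\<close>

lemma measurable_cond_marginal:
  assumes k: "k \<in> {0, 1}"
  shows "cond_marginal B k \<in> init_space B \<rightarrow>\<^sub>M subprob_algebra (sample_space B)"
proof (rule measurable_subprob_algebra)
  fix A assume A: "A \<in> sets (sample_space B)"
  let ?I = "\<lambda>x. \<integral>\<^sup>+\<theta>. likelihood B k \<theta> x * cond_model B k \<theta> x A \<partial>prior B k"
  have "(\<lambda>(x, \<theta>). likelihood B k \<theta> x * cond_model B k \<theta> x A) \<in>
      borel_measurable (init_space B \<Otimes>\<^sub>M prior B k)"
    using measurable_likelihood[OF k] measurable_cond_model[OF k A] by (simp add: case_prod_beta')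
  then have "?I \<in> borel_measurable (init_space B)"
    by (rule sigma_finite_measure.borel_measurable_nn_integral
        [OF prior_sigma_finite[OF k init_space_nonempty]])
  then have "(\<lambda>x. ?I x / evidence B k x) \<in> borel_measurable (init_space B)"
    using measurable_evidence[OF k] by simp
  then show "(\<lambda>x. emeasure (cond_marginal B k x) A) \<in> borel_measurable (init_space B)"
  proof (rule measurable_cong[THEN iffD1, rotated])
    fix x assume x: "x \<in> space (init_space B)"
    show "?I x / evidence B k x = emeasure (cond_marginal B k x) A"
      unfolding evidence_emeasure_cond_marginal[OF k x A, symmetric]
      using evidence_pos_finite[OF k x]
      by (simp add: mult.commute[of "evidence B k x"] mult_divide_eq_ennreal less_top)
  qed
qed (simp_all add: prob_space_imp_subprob_space cond_marginal_prob_space[OF k])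

text \<open>
  After the exchange of integrals, each model sees the integral of its own conditional
  probabilities over the event that the initial sample lies in \<open>C\<close>.
\<close>

lemma nn_integral_evidence_emeasure:
  assumes k: "k \<in> {0, 1}" and A: "A \<in> sets (sample_space B)" and C[measurable]: "C \<in> sets (init_space B)"
  shows "(\<integral>\<^sup>+x. evidence B k x * indicator C x * emeasure (cond_marginal B k x) A \<partial>init_law) =
    (\<integral>\<^sup>+\<omega>. indicator C (init_sample B \<omega>) * indicator A \<omega> \<partial>bayes_marginal B k)"
proof -
  note [measurable] = measurable_cond_model[OF k A]
  have "(\<integral>\<^sup>+x. evidence B k x * indicator C x * emeasure (cond_marginal B k x) A \<partial>init_law) =
      (\<integral>\<^sup>+x. \<integral>\<^sup>+\<theta>. likelihood B k \<theta> x * (indicator C x * cond_model B k \<theta> x A) \<partial>prior B k \<partial>init_law)"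
  proof (rule nn_integral_cong)
    fix x assume "x \<in> space init_law"
    then have x: "x \<in> space (init_space B)" by (simp add: space_obs_space_init)
    show "evidence B k x * indicator C x * emeasure (cond_marginal B k x) A =
        (\<integral>\<^sup>+\<theta>. likelihood B k \<theta> x * (indicator C x * cond_model B k \<theta> x A) \<partial>prior B k)"
      using evidence_emeasure_cond_marginal[OF k x A] by (cases "x \<in> C") auto
  qed
  also have "\<dots> = (\<integral>\<^sup>+\<theta>. \<integral>\<^sup>+\<omega>. indicator C (init_sample B \<omega>) * cond_model B k \<theta> (init_sample B \<omega>) A
      \<partial>model B k \<theta> \<partial>prior B k)"
    by (rule nn_integral_likelihood[OF k]) measurable
  also have "\<dots> = (\<integral>\<^sup>+\<theta>. \<integral>\<^sup>+\<omega>. indicator C (init_sample B \<omega>) * indicator A \<omega> \<partial>model B k \<theta> \<partial>prior B k)"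
    by (intro nn_integral_cong cond_model_integral k A C)
  also have "\<dots> = (\<integral>\<^sup>+\<omega>. indicator C (init_sample B \<omega>) * indicator A \<omega> \<partial>bayes_marginal B k)"
    using init_sample_measurable A by (intro nn_integral_bayes_marginal[OF k, symmetric]) simp
  finally show ?thesis .
qed

text \<open>
  The step from events to functions: both sides are integrals of \<open>g\<close> under the same measure, once
  composed from the kernel and once as the marginal restricted to the event of \<open>C\<close>.
\<close>

lemma disintegration:
  assumes k: "k \<in> {0, 1}" and C[measurable]: "C \<in> sets (init_space B)"
    and g: "g \<in> borel_measurable (sample_space B)"
  shows "(\<integral>\<^sup>+x. evidence B k x * indicator C x * (\<integral>\<^sup>+\<omega>. g \<omega> \<partial>cond_marginal B k x) \<partial>init_law) =
    (\<integral>\<^sup>+\<omega>. indicator C (init_sample B \<omega>) * g \<omega> \<partial>bayes_marginal B k)"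
proof -
  note sets_bm = sets_bayes_marginal[OF k init_space_nonempty]
  have kernel: "cond_marginal B k \<in> init_law \<rightarrow>\<^sub>M subprob_algebra (sample_space B)"
    unfolding measurable_init_law by (rule measurable_cond_marginal[OF k])
  have w: "(\<lambda>x. evidence B k x * indicator C x) \<in> borel_measurable init_law"
    unfolding measurable_init_law using measurable_evidence[OF k] by simp
  have ind: "(\<lambda>\<omega>. indicator C (init_sample B \<omega>) :: ennreal) \<in> borel_measurable (bayes_marginal B k)"
    using init_sample_measurable unfolding measurable_cong_sets[OF sets_bm refl] by simp
  let ?N = "density init_law (\<lambda>x. evidence B k x * indicator C x)"
  have kernel_N: "cond_marginal B k \<in> ?N \<rightarrow>\<^sub>M subprob_algebra (sample_space B)"
    using kernel by simp
  have ne: "space ?N \<noteq> {}"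
    using init_space_nonempty by (simp add: space_obs_space_init)
  have "?N \<bind> cond_marginal B k = density (bayes_marginal B k) (\<lambda>\<omega>. indicator C (init_sample B \<omega>))"
  proof (rule measure_eqI)
    show "sets (?N \<bind> cond_marginal B k) =
        sets (density (bayes_marginal B k) (\<lambda>\<omega>. indicator C (init_sample B \<omega>)))"
      using sets_bind[OF sets_cond_marginal ne] by (simp add: sets_bm)
    fix A assume "A \<in> sets (?N \<bind> cond_marginal B k)"
    then have A: "A \<in> sets (sample_space B)"
      using sets_bind[OF sets_cond_marginal ne] by simp
    have "emeasure (?N \<bind> cond_marginal B k) A = (\<integral>\<^sup>+x. emeasure (cond_marginal B k x) A \<partial>?N)"
      by (rule emeasure_bind[OF ne kernel_N A])
    also have "\<dots> = (\<integral>\<^sup>+x. evidence B k x * indicator C x * emeasure (cond_marginal B k x) A \<partial>init_law)"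
      by (rule nn_integral_density[OF w measurable_emeasure_kernel[OF kernel A]])
    also have "\<dots> = (\<integral>\<^sup>+\<omega>. indicator C (init_sample B \<omega>) * indicator A \<omega> \<partial>bayes_marginal B k)"
      by (rule nn_integral_evidence_emeasure[OF k A C])
    also have "\<dots> = emeasure (density (bayes_marginal B k) (\<lambda>\<omega>. indicator C (init_sample B \<omega>))) A"
      using A by (intro emeasure_density[OF ind, symmetric]) (simp add: sets_bm)
    finally show "emeasure (?N \<bind> cond_marginal B k) A = \<dots>" .
  qed
  then have "(\<integral>\<^sup>+\<omega>. g \<omega> \<partial>(?N \<bind> cond_marginal B k)) =
      (\<integral>\<^sup>+\<omega>. g \<omega> \<partial>density (bayes_marginal B k) (\<lambda>\<omega>. indicator C (init_sample B \<omega>)))"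
    by simp
  also have "\<dots> = (\<integral>\<^sup>+\<omega>. indicator C (init_sample B \<omega>) * g \<omega> \<partial>bayes_marginal B k)"
    using g by (intro nn_integral_density ind) (simp add: measurable_cong_sets[OF sets_bm refl])
  also have "(\<integral>\<^sup>+\<omega>. g \<omega> \<partial>(?N \<bind> cond_marginal B k)) = (\<integral>\<^sup>+x. \<integral>\<^sup>+\<omega>. g \<omega> \<partial>cond_marginal B k x \<partial>?N)"
    by (rule nn_integral_bind[OF g kernel_N])
  also have "\<dots> = (\<integral>\<^sup>+x. evidence B k x * indicator C x * (\<integral>\<^sup>+\<omega>. g \<omega> \<partial>cond_marginal B k x) \<partial>init_law)"
    by (rule nn_integral_density[OF w measurable_compose[OF kernel nn_integral_measurable_subprob_algebra[OF g]]])
  finally show ?thesis .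
qed

end

section \<open>Calibration of the stopped posterior odds\<close>

context bayes_factor_setting_init
begin

text \<open>
  Both sides, integrated over an arbitrary set \<open>C\<close> of initial samples, are the two sides of
  \<open>emeasure_stopped_change\<close>. Since the reference law is sigma-finite, the integrands agree almost
  everywhere.
\<close>

lemma AE_stopped_change:
  assumes \<tau>: "is_stopping_time B \<tau>" and A[measurable]: "A \<in> sets borel" and A_pos: "A \<subseteq> {0<..}"
  shows "AE x in init_law.
    evidence B 1 x * emeasure (cond_marginal B 1 x) (stopped_odds B \<tau> -` A \<inter> space (sample_space B)) =
    evidence B 0 x * (\<integral>\<^sup>+\<omega>. ennreal (stopped_odds B \<tau> \<omega> / prior_odds B) *
      indicator A (stopped_odds B \<tau> \<omega>) \<partial>cond_marginal B 0 x)"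
proof (rule sigma_finite_measure.density_unique2[OF sigma_finite_init_law])
  note [measurable] = measurable_stopped_odds[OF \<tau>]
  let ?S = "stopped_odds B \<tau> -` A \<inter> space (sample_space B)"
  let ?g = "\<lambda>\<omega>. ennreal (stopped_odds B \<tau> \<omega> / prior_odds B) * indicator A (stopped_odds B \<tau> \<omega>)"
  have S: "?S \<in> sets (sample_space B)" by measurable
  have g: "?g \<in> borel_measurable (sample_space B)" by measurable
  show "(\<lambda>x. evidence B 1 x * emeasure (cond_marginal B 1 x) ?S) \<in> borel_measurable init_law"
    unfolding measurable_init_law
    using measurable_evidence[of 1] measurable_emeasure_kernel[OF measurable_cond_marginal[of 1] S] by simp
  show "(\<lambda>x. evidence B 0 x * (\<integral>\<^sup>+\<omega>. ?g \<omega> \<partial>cond_marginal B 0 x)) \<in> borel_measurable init_law"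
    unfolding measurable_init_law
    using measurable_evidence[of 0]
      measurable_compose[OF measurable_cond_marginal[of 0] nn_integral_measurable_subprob_algebra[OF g]]
    by simp
  fix C assume "C \<in> sets init_law"
  then have C: "C \<in> sets (init_space B)" by (simp add: sets_obs_space_init)
  note sets_bm = sets_bayes_marginal[OF _ init_space_nonempty]
  let ?T = "{\<omega> \<in> space (sample_space B). stopped_odds B \<tau> \<omega> \<in> A \<and> init_sample B \<omega> \<in> C}"
  have T: "?T \<in> sets (sample_space B)"
  proof -
    have "?T = ?S \<inter> (init_sample B -` C \<inter> space (sample_space B))" by auto
    then show ?thesis using S measurable_sets[OF init_sample_measurable C] by simp
  qed
  have "(\<integral>\<^sup>+x\<in>C. evidence B 1 x * emeasure (cond_marginal B 1 x) ?S \<partial>init_law) =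
      (\<integral>\<^sup>+x. evidence B 1 x * indicator C x * emeasure (cond_marginal B 1 x) ?S \<partial>init_law)"
    by (simp add: ac_simps)
  also have "\<dots> = (\<integral>\<^sup>+\<omega>. indicator C (init_sample B \<omega>) * indicator ?S \<omega> \<partial>bayes_marginal B 1)"
    by (rule nn_integral_evidence_emeasure[OF _ S C]) simp
  also have "\<dots> = (\<integral>\<^sup>+\<omega>. indicator ?T \<omega> \<partial>bayes_marginal B 1)"
    by (rule nn_integral_cong) (auto split: split_indicator)
  also have "\<dots> = emeasure (bayes_marginal B 1) ?T"
    using T by (intro nn_integral_indicator) (simp add: sets_bm)
  also have "\<dots> = (\<integral>\<^sup>+\<omega>. ennreal (stopped_odds B \<tau> \<omega> / prior_odds B) * indicator ?T \<omega> \<partial>bayes_marginal B 0)"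
    by (rule emeasure_stopped_change[OF \<tau> init_space_nonempty A A_pos C])
  also have "\<dots> = (\<integral>\<^sup>+\<omega>. indicator C (init_sample B \<omega>) * ?g \<omega> \<partial>bayes_marginal B 0)"
    using sets_eq_imp_space_eq[OF sets_bm[of 0]]
    by (intro nn_integral_cong) (auto split: split_indicator)
  also have "\<dots> = (\<integral>\<^sup>+x. evidence B 0 x * indicator C x * (\<integral>\<^sup>+\<omega>. ?g \<omega> \<partial>cond_marginal B 0 x) \<partial>init_law)"
    by (rule disintegration[OF _ C g, symmetric]) simp
  also have "\<dots> = (\<integral>\<^sup>+x\<in>C. evidence B 0 x * (\<integral>\<^sup>+\<omega>. ?g \<omega> \<partial>cond_marginal B 0 x) \<partial>init_law)"
    by (simp add: ac_simps)
  finally show "(\<integral>\<^sup>+x\<in>C. evidence B 1 x * emeasure (cond_marginal B 1 x) ?S \<partial>init_law) = \<dots>" .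
qed

text \<open>
  The Bayes factor of the initial sample is the ratio of the evidences, which exchanges the prior
  odds for the odds after the initial sample.
\<close>

lemma init_odds_evidence:
  assumes "\<And>k. k \<in> {0, 1} \<Longrightarrow> marginal_density B k (init_len B) x = evidence B k x"
    and x: "x \<in> space (init_space B)"
  shows "init_odds B x > 0"
    and "ennreal (y / prior_odds B) * evidence B 0 x = ennreal (y / init_odds B x) * evidence B 1 x"
proof -
  define r where "r = enn2real (evidence B 1 x / evidence B 0 x)"
  have Z: "0 < evidence B k x" "evidence B k x < \<infinity>" if "k \<in> {0, 1}" for k
    using evidence_pos_finite[OF that x] by auto
  have r: "evidence B 0 x * ennreal r = evidence B 1 x"
    unfolding r_def using Z by (intro ennreal_mult_enn2real_divide) auto
  have r_pos: "r > 0"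
    using r Z(1)[of 1] by (cases "r > 0") (auto simp: ennreal_neg)
  have odds: "init_odds B x = r * prior_odds B"
    using init_len_pos assms(1) by (simp add: init_odds_def bayes_factor_def r_def)
  show "init_odds B x > 0"
    using r_pos prior_odds_pos by (simp add: odds)
  have "ennreal (y / prior_odds B) = ennreal (y / init_odds B x * r)"
    using r_pos by (simp add: odds)
  also have "\<dots> = ennreal (y / init_odds B x) * ennreal r"
    using r_pos by (intro ennreal_mult'') simp
  finally have "ennreal (y / prior_odds B) = ennreal (y / init_odds B x) * ennreal r" .
  then show "ennreal (y / prior_odds B) * evidence B 0 x = ennreal (y / init_odds B x) * evidence B 1 x"
    by (simp only: r[symmetric] ac_simps)
qed

text \<open>
  The null sets of the rays with nonnegative rational endpoints are united, and the positive
  finite evidence is then cancelled at each remaining point.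
\<close>

lemma AE_density_positive_law_init:
  assumes \<tau>: "is_stopping_time B \<tau>"
  shows "AE x in init_law. init_odds B x > 0 \<and>
    is_density (positive_law (cond_marginal B 0 x) (stopped_odds B \<tau>))
      (positive_law (cond_marginal B 1 x) (stopped_odds B \<tau>)) (\<lambda>b. ennreal (b / init_odds B x))"
proof -
  have "AE x in init_law. \<forall>q :: rat. q \<ge> 0 \<longrightarrow>
    evidence B 1 x * emeasure (cond_marginal B 1 x)
      (stopped_odds B \<tau> -` {of_rat q<..} \<inter> space (sample_space B)) =
    evidence B 0 x * (\<integral>\<^sup>+\<omega>. ennreal (stopped_odds B \<tau> \<omega> / prior_odds B) *
      indicator {of_rat q<..} (stopped_odds B \<tau> \<omega>) \<partial>cond_marginal B 0 x)"
    unfolding AE_all_countable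
  proof (intro allI)
    fix q :: rat
    show "AE x in init_law. q \<ge> 0 \<longrightarrow>
      evidence B 1 x * emeasure (cond_marginal B 1 x)
        (stopped_odds B \<tau> -` {of_rat q<..} \<inter> space (sample_space B)) =
      evidence B 0 x * (\<integral>\<^sup>+\<omega>. ennreal (stopped_odds B \<tau> \<omega> / prior_odds B) *
        indicator {of_rat q<..} (stopped_odds B \<tau> \<omega>) \<partial>cond_marginal B 0 x)"
    proof (cases "q \<ge> 0")
      case True
      then have "{of_rat q<..} \<subseteq> {0 :: real<..}"
        by (simp add: zero_le_of_rat_iff)
      then show ?thesis using AE_stopped_change[OF \<tau>, of "{of_rat q<..}"] by simp
    qed simp
  qed
  moreover have "AE x in init_law. marginal_density B 0 (init_len B) x = evidence B 0 x"
    by (rule AE_marginal_density_eq_evidence) simp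
  moreover have "AE x in init_law. marginal_density B 1 (init_len B) x = evidence B 1 x"
    by (rule AE_marginal_density_eq_evidence) simp
  ultimately show ?thesis
    using AE_space
  proof eventually_elim
    case (elim x)
    then have x: "x \<in> space (init_space B)" by (simp add: space_obs_space_init)
    have dens: "marginal_density B k (init_len B) x = evidence B k x" if "k \<in> {0, 1}" for k
      using elim that by auto
    have pos: "init_odds B x > 0" by (rule init_odds_evidence(1)[OF dens x])
    note Z = evidence_pos_finite[of 1, OF _ x, simplified]
    have [measurable]: "stopped_odds B \<tau> \<in> borel_measurable (cond_marginal B k x)" for k
      using measurable_stopped_odds[OF \<tau>] unfolding measurable_cong_sets[OF sets_cond_marginal refl] .
    have "is_density (positive_law (cond_marginal B 0 x) (stopped_odds B \<tau>))
      (positive_law (cond_marginal B 1 x) (stopped_odds B \<tau>)) (\<lambda>b. ennreal (b / init_odds B x))"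
    proof (rule is_density_positive_law_finite)
      show "finite_measure (cond_marginal B 1 x)"
        using cond_marginal_prob_space[of 1 x] x by (simp add: prob_space.finite_measure)
      fix q :: rat assume "q \<ge> 0"
      let ?S = "stopped_odds B \<tau> -` {of_rat q<..} \<inter> space (sample_space B)"
      let ?J = "\<lambda>c. \<integral>\<^sup>+\<omega>. ennreal (stopped_odds B \<tau> \<omega> / c) *
          indicator {of_rat q<..} (stopped_odds B \<tau> \<omega>) \<partial>cond_marginal B 0 x"
      have "evidence B 1 x * emeasure (cond_marginal B 1 x) ?S = evidence B 0 x * ?J (prior_odds B)"
        using elim \<open>q \<ge> 0\<close> by blast
      also have "\<dots> = (\<integral>\<^sup>+\<omega>. evidence B 0 x * (ennreal (stopped_odds B \<tau> \<omega> / prior_odds B) *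
          indicator {of_rat q<..} (stopped_odds B \<tau> \<omega>)) \<partial>cond_marginal B 0 x)"
        by (rule nn_integral_cmult[symmetric]) measurable
      also have "\<dots> = (\<integral>\<^sup>+\<omega>. evidence B 1 x * (ennreal (stopped_odds B \<tau> \<omega> / init_odds B x) *
          indicator {of_rat q<..} (stopped_odds B \<tau> \<omega>)) \<partial>cond_marginal B 0 x)"
      proof (rule nn_integral_cong)
        fix \<omega>
        show "evidence B 0 x * (ennreal (stopped_odds B \<tau> \<omega> / prior_odds B) *
            indicator {of_rat q<..} (stopped_odds B \<tau> \<omega>)) =
          evidence B 1 x * (ennreal (stopped_odds B \<tau> \<omega> / init_odds B x) *
            indicator {of_rat q<..} (stopped_odds B \<tau> \<omega>))"
          using init_odds_evidence(2)[OF dens x, of "stopped_odds B \<tau> \<omega>"]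
          by (metis mult.assoc mult.commute)
      qed
      also have "\<dots> = evidence B 1 x * ?J (init_odds B x)"
        by (rule nn_integral_cmult) measurable
      finally have "evidence B 1 x * emeasure (cond_marginal B 1 x) ?S =
          evidence B 1 x * ?J (init_odds B x)" .
      then show "emeasure (cond_marginal B 1 x)
          (stopped_odds B \<tau> -` {of_rat q<..} \<inter> space (cond_marginal B 0 x)) = ?J (init_odds B x)"
        using Z by (auto simp: ennreal_mult_cancel_left)
    qed (use pos in simp_all)
    with pos show ?case by simp
  qed
qed

end

text \<open>
  Without an initial sample the conditional marginals are the marginals and the odds are the prior
  odds, so the claim is the unconditional one.
\<close>

lemma (in bayes_factor_setting) AE_density_positive_law_cond_marginal:
  assumes \<tau>: "is_stopping_time B \<tau>"
  shows "AE x in obs_law B (init_len B) (reference B). init_odds B x > 0 \<and>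
    is_density (positive_law (cond_marginal B 0 x) (stopped_odds B \<tau>))
      (positive_law (cond_marginal B 1 x) (stopped_odds B \<tau>)) (\<lambda>b. ennreal (b / init_odds B x))"
proof (cases "space (init_space B) = {} \<or> init_len B = 0")
  case True
  show ?thesis
  proof (rule AE_I2)
    fix x assume "x \<in> space (obs_law B (init_len B) (reference B))"
    then have x: "x \<in> space (init_space B)" by (simp add: space_obs_space_init)
    then have "init_len B = 0" "space (init_space B) \<noteq> {}" using True by auto
    then show "init_odds B x > 0 \<and>
      is_density (positive_law (cond_marginal B 0 x) (stopped_odds B \<tau>))
        (positive_law (cond_marginal B 1 x) (stopped_odds B \<tau>)) (\<lambda>b. ennreal (b / init_odds B x))"
      using density_positive_law_bayes_marginal[OF \<tau>] cond_marginal_no_init[OF _ x] prior_odds_pos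
      by (simp add: init_odds_def)
  qed
next
  case False
  then interpret bayes_factor_setting_init B
    by unfold_locales auto
  show ?thesis by (rule AE_density_positive_law_init[OF \<tau>])
qed

theorem corollary3:
  fixes B :: "('w, 'x, 't) bayes_model" and \<tau> :: "'w \<Rightarrow> enat"
  assumes "bayes_factor_setting B"
    and "is_stopping_time B \<tau>"
    and "\<And>k x. k \<in> {0, 1} \<Longrightarrow> x \<in> space (init_space B) \<Longrightarrow>
      emeasure (cond_marginal B k x) {\<omega> \<in> space (sample_space B). \<tau> \<omega> = \<infinity>} = 0"
  shows "AE x in obs_law B (init_len B) (reference B).
    (\<exists>f. is_density (positive_law (cond_marginal B 0 x) (stopped_odds B \<tau>))
            (positive_law (cond_marginal B 1 x) (stopped_odds B \<tau>)) f \<and>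
         (AE b in positive_law (cond_marginal B 0 x) (stopped_odds B \<tau>).
            ennreal (init_odds B x) * f b = ennreal b)) \<and>
    (\<exists>f. is_density (positive_law (bayes_marginal B 0) (stopped_odds B \<tau>))
            (positive_law (bayes_marginal B 1) (stopped_odds B \<tau>)) f \<and>
         (AE b in positive_law (bayes_marginal B 0) (stopped_odds B \<tau>).
            ennreal (prior_odds B) * f b = ennreal b) \<and>
         (AE b in positive_law (cond_marginal B 0 x) (stopped_odds B \<tau>).
            ennreal (prior_odds B) * f b = ennreal b))"
proof -
  interpret bayes_factor_setting B by fact
  have cancel: "AE b in M. ennreal c * ennreal (b / c) = ennreal b" if "c > 0" for c and M :: "real measure"
    using that by (simp add: ennreal_mult'[symmetric])
  show ?thesis
    using AE_density_positive_law_cond_marginal[OF assms(2)] AE_space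
  proof eventually_elim
    case (elim x)
    then have "space (init_space B) \<noteq> {}" by (auto simp: space_obs_space_init)
    then have marginal: "is_density (positive_law (bayes_marginal B 0) (stopped_odds B \<tau>))
        (positive_law (bayes_marginal B 1) (stopped_odds B \<tau>)) (\<lambda>b. ennreal (b / prior_odds B))"
      by (rule density_positive_law_bayes_marginal[OF assms(2)])
    show ?case
    proof (intro conjI)
      show "\<exists>f. is_density (positive_law (cond_marginal B 0 x) (stopped_odds B \<tau>))
            (positive_law (cond_marginal B 1 x) (stopped_odds B \<tau>)) f \<and>
          (AE b in positive_law (cond_marginal B 0 x) (stopped_odds B \<tau>).
            ennreal (init_odds B x) * f b = ennreal b)"
        using elim cancel by blast
      show "\<exists>f. is_density (positive_law (bayes_marginal B 0) (stopped_odds B \<tau>))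
            (positive_law (bayes_marginal B 1) (stopped_odds B \<tau>)) f \<and>
          (AE b in positive_law (bayes_marginal B 0) (stopped_odds B \<tau>).
            ennreal (prior_odds B) * f b = ennreal b) \<and>
          (AE b in positive_law (cond_marginal B 0 x) (stopped_odds B \<tau>).
            ennreal (prior_odds B) * f b = ennreal b)"
        using marginal cancel[OF prior_odds_pos] by blast
    qed
  qed
qed

end
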